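(* Let $\mathcal H$ be a real Hilbert space; let $A,C:\mathcal H\rightrightarrows\mathcal H$ be maximal monotone; let $\Omega\subset\mathcal H$ be nonempty, closed and convex and $F_1:D(F_1)\subset\mathcal H\to\mathcal H$ with $D(C)\subset\Omega\subset D(F_1)$ be monotone on $\Omega$ and satisfy $\|F_1(z)-F_1(z')\|\le L\|z-z'\|$ for all $z,z'\in\Omega$, where $L\ge0$; let $F_2:\mathcal H\to\mathcal H$ be $\eta$-cocoercive, $\eta>0$, i.e. $\langle F_2(z)-F_2(z'),z-z'\rangle\ge\eta\|F_2(z)-F_2(z')\|^2$ for all $z,z'\in\mathcal H$. Put $B:=C+F_1+F_2$ and assume $B^{-1}(0)\ne\emptyset$ and $(A+C+F_1+F_2)^{-1}(0)\neq\emptyset$. Let $z_0\in\mathcal H$, $\tau_0>0$, $0<\sigma,\theta<1$ and $0<\gamma\le\dfrac{4\eta\sigma^2}{1+\sqrt{1+16L^2\eta^2\sigma^2}}$ be the input of Algorithm 5 (described in the context), and assume $\max\{(1-\sigma)^{-1},\sigma^{-1}\}=\mathcal O(1)$. Let $d_{0,\gamma}$ be the distance from $z_0$ to $\mathrm{zer}(S_{\gamma,A,B})$ and $d_{0,b}$ the distance from $z_0$ to $B^{-1}(0)$. Then, for given tolerances $\rho,\epsilon>0$: (a) Algorithm 5 finds $a,b,x,y\in\mathcal H$ and $\varepsilon_b\ge0$ such that $$a\in A(y),\quad b\in C(x)+F_1(x)+F_2^{\varepsilon_b}(x),\quad \gamma\|a+b\|=\|x-y\|\le\rho,\quad \varepsilon_b\le\epsilon\qquad(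 * )$$ after performing no more than $$k_{\mathrm{p;\,outer}}:=\mathcal O\left(1+\max\left\{\frac{d_{0,\gamma}^2}{\rho^2},\frac{d_{0,\gamma}^2}{\gamma\epsilon}\right\}+\max\left\{\log^+\left(\frac{\sqrt{\tau_0}}{\rho}\right),\log^+\left(\frac{\tau_0}{\gamma\epsilon}\right)\right\}\right)$$ outer iterations. (b) Before achieving the desired tolerances $\rho,\epsilon$, each (outer) iteration of Algorithm 5 performs at most $$k_{\mathrm{inner}}:=\mathcal O\left(1+\log^+\left(\frac{d_{0,\gamma}+d_{0,b}}{\sqrt{\tau_0}}\right)+\max\left\{\log^+\left(\frac{\sqrt{\tau_0}}{\rho}\right),\log^+\left(\frac{\tau_0}{\gamma\epsilon}\right)\right\}\right)$$ inner iterations, and hence at most that many evaluations of the $\eta$-cocoercive operator $F_2$. As a consequence, Algorithm 5 finds $a,b,x,y\in\mathcal H$ and $\varepsilon_b\ge0$ satisfying $( * )$ after performing no more than $k_{\mathrm{p;\,outer}}\times k_{\mathrm{inner}}$ inner iterations.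
   Context: Enlargement: for $T:\mathcal H\rightrightarrows\mathcal H$ and $\varepsilon\ge0$, $T^{\varepsilon}(z):=\{v\in\mathcal H : \langle z-z',v-v'\rangle\ge-\varepsilon\ \text{for all } z',v' \text{ with } v'\in T(z')\}$ (point-to-point maps are viewed as set-valued ones). Operator $S_{\gamma,A,B}$: the maximal monotone operator on $\mathcal H$ with graph $\{(y+\gamma b,\gamma a+\gamma b) : b\in B(x),\ a\in A(y),\ \gamma a+y=x-\gamma b\}$; $\mathrm{zer}(S):=S^{-1}(0)$. Under the stated assumptions $B=C+F_1+F_2$ is maximal monotone. Algorithm 4 (inner, Tseng forward-backward type). Input $C,F_1,\Omega,L,F_2,\eta,\sigma,\gamma$ as in the claim, a point $\mathring z\in\mathcal H$ and $\mathring\tau>0$. Set $w_0=\mathring z$. For $j=1,2,\dots$ (each $j$ is an inner iteration): $w'_{j-1}=P_\Omega(w_{j-1})$ (orthogonal projection), $$\widetilde w_j=\left(\tfrac\gamma2C+I\right)^{-1}\left(\frac{\mathring z+w_{j-1}-\gamma(F_1+F_2)(w'_{j-1})}{2}\right),\qquad w_j=\widetilde w_j-\gamma\big(F_1(\widetilde w_j)-F_1(w'_{j-1})\big);$$ if $\|w_{j-1}-w_j\|^2+\frac{\gamma\|w'_{j-1}-\widetilde w_j\|^2}{2\eta}\le\mathring\tau$, terminate and output $(w_{j-1},w'_{j-1},w_j,\widetilde w_j)$. Algorithm 5 (Douglas-Rachford-Tseng four-operator splitting). For $k=1,2,\dots$ (outer iterations): (1) run Algorithm 4 with $(\mathring z,\mathring\tau)=(z_{k-1},\tau_{k-1})$,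 obtain $(w_{j-1},w'_{j-1},w_j,\widetilde w_j)$ and set $x_k=\widetilde w_j$, $b_k=\frac{z_{k-1}+w_{j-1}-(w_j+\widetilde w_j)}{\gamma}$, $\varepsilon_{b,k}=\frac{\|w'_{j-1}-\widetilde w_j\|^2}{4\eta}$; (2) compute $(y_k,a_k)$ with $a_k\in A(y_k)$ and $\gamma a_k+y_k=x_k-\gamma b_k$; (3) if $\|\gamma b_k+x_k-z_{k-1}\|^2+2\gamma\varepsilon_{b,k}\le\sigma^2\|\gamma b_k+y_k-z_{k-1}\|^2$, set $z_k=z_{k-1}-\gamma(a_k+b_k)$, $\tau_k=\tau_{k-1}$ (extragradient step); otherwise set $z_k=z_{k-1}$, $\tau_k=\theta\tau_{k-1}$ (null step). Conventions: $\log^+ t:=\max\{\log t,0\}$. "Finds within $N$ outer iterations" means that for some $k\le N$ the tuple $(a,b,x,y,\varepsilon_b):=(a_k,b_k,x_k,y_k,\varepsilon_{b,k})$ satisfies $( * )$; "before achieving the desired tolerances" refers to the outer iterations up to and including the first such $k$. The assumption $\max\{(1-\sigma)^{-1},\sigma^{-1}\}=\mathcal O(1)$ means that this quantity is bounded by a fixed constant $M$; the constants implied by $\mathcal O(\cdot)$ depend only on $M$ and on $\theta$ (treated as fixed), and not on the operators, $\mathcal H,L,\eta,z_0,\gamma,\tau_0,\rho,\epsilon$. *)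

theory Defs
  imports "HOL-Analysis.Analysis" "HOL-Library.Set_Algebras" "HOL-Library.Extended_Nat"
begin

text \<open>A set-valued operator on a space \<open>'a\<close> is a function \<open>'a \<Rightarrow> 'a set\<close>. A single-valued map
  \<open>F\<close> is viewed as \<open>\<lambda>x. {F x}\<close>, and sums of operators are pointwise Minkowski sums
  (\<open>HOL-Library.Set_Algebras\<close>), so that a sum is empty wherever one of the summands is.\<close>

definition operator_domain :: "('a \<Rightarrow> 'b set) \<Rightarrow> 'a set" where
  "operator_domain T = {x. T x \<noteq> {}}"

definition operator_zeros :: "('a \<Rightarrow> 'b::zero set) \<Rightarrow> 'a set" where
  "operator_zeros T = {x. 0 \<in> T x}"

definition monotone_operator :: "('a::real_inner \<Rightarrow> 'a set) \<Rightarrow> bool" where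
  "monotone_operator T \<longleftrightarrow> (\<forall>x y. \<forall>u\<in>T x. \<forall>v\<in>T y. inner (x - y) (u - v) \<ge> 0)"

definition maximal_monotone :: "('a::real_inner \<Rightarrow> 'a set) \<Rightarrow> bool" where
  "maximal_monotone T \<longleftrightarrow> monotone_operator T \<and>
     (\<forall>S. monotone_operator S \<and> (\<forall>x. T x \<subseteq> S x) \<longrightarrow> S = T)"

definition enlargement :: "real \<Rightarrow> ('a::real_inner \<Rightarrow> 'a set) \<Rightarrow> 'a \<Rightarrow> 'a set" where
  "enlargement e T z = {v. \<forall>z' v'. v' \<in> T z' \<longrightarrow> inner (z - z') (v - v') \<ge> - e}"

definition splitting_operator ::
  "real \<Rightarrow> ('a::real_inner \<Rightarrow> 'a set) \<Rightarrow> ('a \<Rightarrow> 'a set) \<Rightarrow> 'a \<Rightarrow> 'a set" where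
  "splitting_operator \<gamma> A B z =
     {v. \<exists>a b x y. b \<in> B x \<and> a \<in> A y \<and> \<gamma> *\<^sub>R a + y = x - \<gamma> *\<^sub>R b
           \<and> z = y + \<gamma> *\<^sub>R b \<and> v = \<gamma> *\<^sub>R a + \<gamma> *\<^sub>R b}"

text \<open>\<open>(\<lambda>T + I)\<^sup>-\<^sup>1\<close>. For maximal monotone \<open>T\<close> and \<open>\<lambda> > 0\<close> on a Hilbert space this is a
  well-defined single-valued map on the whole space (Minty).\<close>

definition resolvent :: "real \<Rightarrow> ('a::real_vector \<Rightarrow> 'a set) \<Rightarrow> 'a \<Rightarrow> 'a" where
  "resolvent l T u = (THE z. \<exists>v\<in>T z. u = l *\<^sub>R v + z)"

text \<open>The library's \<open>closest_point\<close> is restricted to Heine-Borel (finite-dimensional) spaces.\<close>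

definition projection :: "'a::metric_space set \<Rightarrow> 'a \<Rightarrow> 'a" where
  "projection S u = (THE p. p \<in> S \<and> (\<forall>q\<in>S. dist u p \<le> dist u q))"


text \<open>State of the inner algorithm (Tseng forward-backward type) after \<open>j\<close> inner iterations:
  \<open>w_prev\<close> is \<open>w\<^bsub>j-1\<^esub>\<close>, \<open>w_proj\<close> is \<open>w'\<^bsub>j-1\<^esub>\<close>, \<open>w_next\<close> is \<open>w\<^bsub>j\<^esub>\<close>, \<open>w_tilde\<close> is the backward
  point of iteration \<open>j\<close>, and \<open>n_F2\<close> counts the evaluations of \<open>F2\<close> made so far. Before the first
  iteration only \<open>w_next\<close> and \<open>n_F2\<close> are meaningful.\<close>

record 'a tseng_state =
  w_prev :: 'a
  w_proj :: 'a
  w_next :: 'a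
  w_tilde :: 'a
  n_F2 :: nat

primrec tseng ::
  "('a::real_inner \<Rightarrow> 'a set) \<Rightarrow> 'a set \<Rightarrow> ('a \<Rightarrow> 'a) \<Rightarrow> ('a \<Rightarrow> 'a) \<Rightarrow> real \<Rightarrow> 'a \<Rightarrow> nat \<Rightarrow> 'a tseng_state"
where
  "tseng C \<Omega> F1 F2 \<gamma> zr 0 = \<lparr>w_prev = zr, w_proj = zr, w_next = zr, w_tilde = zr, n_F2 = 0\<rparr>"
| "tseng C \<Omega> F1 F2 \<gamma> zr (Suc j) =
    (let s = tseng C \<Omega> F1 F2 \<gamma> zr j;
         w = w_next s;
         w' = projection \<Omega> w;
         f1 = F1 w';
         f2 = F2 w';
         wt = resolvent (\<gamma> / 2) C ((1 / 2) *\<^sub>R (zr + w - \<gamma> *\<^sub>R (f1 + f2)))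
     in \<lparr>w_prev = w, w_proj = w', w_next = wt - \<gamma> *\<^sub>R (F1 wt - f1), w_tilde = wt,
         n_F2 = n_F2 s + 1\<rparr>)"

definition tseng_stop :: "real \<Rightarrow> real \<Rightarrow> real \<Rightarrow> 'a::real_inner tseng_state \<Rightarrow> bool" where
  "tseng_stop \<gamma> \<eta> \<tau>r s \<longleftrightarrow>
     (norm (w_prev s - w_next s))\<^sup>2 + \<gamma> * (norm (w_proj s - w_tilde s))\<^sup>2 / (2 * \<eta>) \<le> \<tau>r"

text \<open>Number of inner iterations of a call; \<open>\<infinity>\<close> means that the call does not terminate.\<close>

definition tseng_iterations ::
  "('a::real_inner \<Rightarrow> 'a set) \<Rightarrow> 'a set \<Rightarrow> ('a \<Rightarrow> 'a) \<Rightarrow> ('a \<Rightarrow> 'a) \<Rightarrow> real \<Rightarrow> real \<Rightarrow> 'a \<Rightarrow> real \<Rightarrow> enat"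
where
  "tseng_iterations C \<Omega> F1 F2 \<eta> \<gamma> zr \<tau>r =
    (let stop = (\<lambda>j. 1 \<le> j \<and> tseng_stop \<gamma> \<eta> \<tau>r (tseng C \<Omega> F1 F2 \<gamma> zr j))
     in if \<exists>j. stop j then enat (LEAST j. stop j) else \<infinity>)"


text \<open>Everything computed in one outer iteration \<open>k\<close>: \<open>it_z\<close>, \<open>it_tau\<close> are \<open>z\<^sub>k\<close>, \<open>\<tau>\<^sub>k\<close> (the values
  after the iteration), and \<open>it_inner\<close>, \<open>it_F2\<close> are the numbers of inner iterations and of
  evaluations of \<open>F2\<close> made by iteration \<open>k\<close> alone.\<close>

record 'a drt_iterate =
  it_z :: 'a
  it_tau :: real
  it_x :: 'a
  it_y :: 'a
  it_a :: 'a
  it_b :: 'a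
  it_eps :: real
  it_inner :: enat
  it_F2 :: nat

definition drt_step ::
  "('a::real_inner \<Rightarrow> 'a set) \<Rightarrow> ('a \<Rightarrow> 'a set) \<Rightarrow> 'a set \<Rightarrow> ('a \<Rightarrow> 'a) \<Rightarrow> ('a \<Rightarrow> 'a) \<Rightarrow>
   real \<Rightarrow> real \<Rightarrow> real \<Rightarrow> real \<Rightarrow> 'a \<Rightarrow> real \<Rightarrow> 'a drt_iterate"
where
  "drt_step A C \<Omega> F1 F2 \<eta> \<sigma> \<theta> \<gamma> z \<tau> =
    (let n = tseng_iterations C \<Omega> F1 F2 \<eta> \<gamma> z \<tau>;
         s = tseng C \<Omega> F1 F2 \<gamma> z (the_enat n);
         x = w_tilde s;
         b = (1 / \<gamma>) *\<^sub>R (z + w_prev s - (w_next s + w_tilde s));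
         e = (norm (w_proj s - w_tilde s))\<^sup>2 / (4 * \<eta>);
         (y, a) = (SOME (y, a). a \<in> A y \<and> \<gamma> *\<^sub>R a + y = x - \<gamma> *\<^sub>R b);
         extragradient = ((norm (\<gamma> *\<^sub>R b + x - z))\<^sup>2 + 2 * \<gamma> * e
                            \<le> \<sigma>\<^sup>2 * (norm (\<gamma> *\<^sub>R b + y - z))\<^sup>2)
     in \<lparr>it_z = (if extragradient then z - \<gamma> *\<^sub>R (a + b) else z),
         it_tau = (if extragradient then \<tau> else \<theta> * \<tau>),
         it_x = x, it_y = y, it_a = a, it_b = b, it_eps = e,
         it_inner = n, it_F2 = n_F2 s\<rparr>)"

text \<open>The outer algorithm. Index \<open>0\<close> only carries the input \<open>z\<^sub>0\<close>, \<open>\<tau>\<^sub>0\<close>; its other fields are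
  placeholders.\<close>

primrec drt ::
  "('a::real_inner \<Rightarrow> 'a set) \<Rightarrow> ('a \<Rightarrow> 'a set) \<Rightarrow> 'a set \<Rightarrow> ('a \<Rightarrow> 'a) \<Rightarrow> ('a \<Rightarrow> 'a) \<Rightarrow>
   real \<Rightarrow> real \<Rightarrow> real \<Rightarrow> real \<Rightarrow> 'a \<Rightarrow> real \<Rightarrow> nat \<Rightarrow> 'a drt_iterate"
where
  "drt A C \<Omega> F1 F2 \<eta> \<sigma> \<theta> \<gamma> z0 \<tau>0 0 =
     \<lparr>it_z = z0, it_tau = \<tau>0, it_x = z0, it_y = z0, it_a = 0, it_b = 0, it_eps = 0,
      it_inner = 0, it_F2 = 0\<rparr>"
| "drt A C \<Omega> F1 F2 \<eta> \<sigma> \<theta> \<gamma> z0 \<tau>0 (Suc k) =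
    (let r = drt A C \<Omega> F1 F2 \<eta> \<sigma> \<theta> \<gamma> z0 \<tau>0 k
     in drt_step A C \<Omega> F1 F2 \<eta> \<sigma> \<theta> \<gamma> (it_z r) (it_tau r))"

text \<open>The tuple \<open>(a, b, x, y, \<epsilon>\<^sub>b)\<close> of an iterate meets the tolerances \<open>\<rho>\<close>, \<open>\<epsilon>\<close>.\<close>

definition meets_tolerances ::
  "('a::real_inner \<Rightarrow> 'a set) \<Rightarrow> ('a \<Rightarrow> 'a set) \<Rightarrow> ('a \<Rightarrow> 'a) \<Rightarrow> ('a \<Rightarrow> 'a) \<Rightarrow>
   real \<Rightarrow> real \<Rightarrow> real \<Rightarrow> 'a drt_iterate \<Rightarrow> bool"
where
  "meets_tolerances A C F1 F2 \<gamma> \<rho> \<epsilon> r \<longleftrightarrow>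
     it_a r \<in> A (it_y r) \<and>
     it_b r \<in> C (it_x r) + {F1 (it_x r)} + enlargement (it_eps r) (\<lambda>z. {F2 z}) (it_x r) \<and>
     \<gamma> * norm (it_a r + it_b r) = norm (it_x r - it_y r) \<and>
     norm (it_x r - it_y r) \<le> \<rho> \<and>
     0 \<le> it_eps r \<and> it_eps r \<le> \<epsilon>"

definition log_plus :: "real \<Rightarrow> real" where
  "log_plus t = (if t \<le> 0 then 0 else max (ln t) 0)"

text \<open>The constants hidden in the two \<open>\<O>\<close>-bounds. They have to be uniform over all Hilbert
  spaces, and a type cannot be quantified under an existential quantifier over the constants:
  an existentially quantified constant could depend on the Hilbert space. Hence they are given
  as closed expressions in \<open>M\<close> and \<open>\<theta>\<close>, with generous numerical factors; \<open>M\<close> bounds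
  \<open>max {(1 - \<sigma>)\<^sup>-\<^sup>1, \<sigma>\<^sup>-\<^sup>1}\<close>. The factors \<open>ln (1 / \<theta>)\<close> come from \<open>\<tau>\<close> being multiplied by \<open>\<theta>\<close> in
  each null step.\<close>

definition outer_const :: "real \<Rightarrow> real \<Rightarrow> real" where
  "outer_const M \<theta> = 4 * M + 4 * ln (1 + M) / ln (1 / \<theta>)"

definition inner_const :: "real \<Rightarrow> real \<Rightarrow> real" where
  "inner_const M \<theta> = 12 * M * (1 + ln (1 + M) + ln (1 / \<theta>))"

end

theory Submission
  imports Defs
begin

text \<open>
  With \<open>b = c + F1 x + F2 w'\<close>, cocoercivity puts \<open>F2 w'\<close> into the enlargement of \<open>F2\<close> at \<open>x\<close>, so each outer
  iteration is an inexact proximal step for \<open>splitting_operator \<gamma> A B\<close>. An extragradient step decreases the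
  squared distance to every zero of that operator by \<open>(1 - \<sigma>\<^sup>2) \<parallel>\<gamma> b + y - z\<parallel>\<^sup>2\<close>, which is bounded below
  while the tolerances are not met; hence the number of such steps is bounded. A null step that misses the tolerances
  forces \<open>\<tau>\<close> to be bounded below, and it multiplies \<open>\<tau>\<close> by \<open>\<theta>\<close>, so there are logarithmically many null steps.

  The inner algorithm solves \<open>z \<in> \<gamma> B x + x\<close>. Strong monotonicity makes the squared distance to the
  solution contract by a fixed factor, and the stopping quantity is at most a constant times this squared distance. The
  initial distance is at most the distance from \<open>z\<close> to a zero of \<open>B\<close>, which is bounded through
  the Fejer property of the outer iterates, and \<open>\<tau>\<close> is bounded below by the preceding argument.
\<close>

subsection \<open>Minty's theorem, projections and resolvents\<close>

text \<open>A minimising sequence of \<open>r + (norm p)\<^sup>2 / 2\<close> has Cauchy first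
  components by the parallelogram identity, and its second components converge because the values
  do. The conclusion is the first-order optimality condition. It serves Minty's theorem and, with
  second component 0, the projection onto a convex set.\<close>

lemma quadratic_epigraph_minimizer:
  fixes K :: "('b::{real_inner,complete_space} \<times> real) set"
  assumes "convex K" and "K \<noteq> {}"
    and lower: "\<And>p r. (p, r) \<in> K \<Longrightarrow> 0 \<le> r + (norm p)\<^sup>2 / 2"
  obtains p r where "(p, r) \<in> closure K"
    and "\<And>q s. (q, s) \<in> K \<Longrightarrow> r + inner p p \<le> s + inner q p"
proof -
  define Q :: "'b \<times> real \<Rightarrow> real" where "Q u = snd u + (norm (fst u))\<^sup>2 / 2" for u
  define m where "m = (INF u\<in>K. Q u)"
  have bdd: "bdd_below (Q ` K)"
    using lower by (intro bdd_belowI[of _ 0]) (auto simp: Q_def)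
  have m_le: "m \<le> Q u" if "u \<in> K" for u
    unfolding m_def using bdd that by (rule cINF_lower)
  have "\<exists>u\<in>K. Q u < m + 1 / Suc n" for n
    using cINF_less_iff[OF \<open>K \<noteq> {}\<close> bdd, of "m + 1 / Suc n"] by (simp add: m_def)
  then obtain u where uK: "\<And>n. u n \<in> K" and uQ: "\<And>n. Q (u n) < m + 1 / Suc n"
    by metis
  define p where "p n = fst (u n)" for n
  have close: "(dist (p i) (p j))\<^sup>2 \<le> 4 * (1 / Suc i + 1 / Suc j)" for i j
  proof -
    let ?w = "(1/2) *\<^sub>R u i + (1/2) *\<^sub>R u j"
    have "?w \<in> K"
      using \<open>convex K\<close> uK by (intro convexD) auto
    then have "m \<le> Q ?w" by (rule m_le)
    also have "Q ?w = (Q (u i) + Q (u j)) / 2 - (dist (p i) (p j))\<^sup>2 / 8"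
      by (simp add: Q_def p_def dist_norm power2_norm_eq_inner inner_add_left inner_add_right
          inner_diff_left inner_diff_right inner_commute field_simps)
    finally have "(dist (p i) (p j))\<^sup>2 \<le> 4 * ((Q (u i) - m) + (Q (u j) - m))"
      by (simp add: field_simps)
    also have "\<dots> \<le> 4 * (1 / Suc i + 1 / Suc j)"
      using uQ[of i] uQ[of j] by (intro mult_left_mono add_mono) (auto simp: algebra_simps)
    finally show ?thesis .
  qed
  have "Cauchy p"
  proof (rule metric_CauchyI)
    fix e :: real assume "e > 0"
    then obtain N where N: "8 * (1 / Suc N) < e\<^sup>2"
      using reals_Archimedean[of "e\<^sup>2 / 8"] by (auto simp: field_simps)
    show "\<exists>M. \<forall>i\<ge>M. \<forall>j\<ge>M. dist (p i) (p j) < e"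
    proof (intro exI allI impI)
      fix i j assume "N \<le> i" "N \<le> j"
      then have "1 / real (Suc i) \<le> 1 / Suc N" "1 / real (Suc j) \<le> 1 / Suc N"
        by (auto intro!: divide_left_mono)
      then have "4 * (1 / real (Suc i) + 1 / real (Suc j)) \<le> 4 * (1 / Suc N + 1 / Suc N)"
        by (intro mult_left_mono add_mono) auto
      also have "\<dots> < e\<^sup>2" using N by simp
      finally have "(dist (p i) (p j))\<^sup>2 < e\<^sup>2"
        using close[of i j] by (rule le_less_trans[rotated])
      then show "dist (p i) (p j) < e"
        using \<open>e > 0\<close> by (intro power_less_imp_less_base[of _ 2 e]) auto
    qed
  qed
  then obtain pl where pl: "p \<longlonglongrightarrow> pl"
    using Cauchy_convergent convergent_def by blast
  have Qlim: "(\<lambda>n. Q (u n)) \<longlonglongrightarrow> m"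
  proof (rule tendsto_sandwich)
    show "\<forall>\<^sub>F n in sequentially. m \<le> Q (u n)"
      using m_le[OF uK] by simp
    show "\<forall>\<^sub>F n in sequentially. Q (u n) \<le> m + 1 / Suc n"
      using uQ by (simp add: less_imp_le)
    show "(\<lambda>n. m + 1 / Suc n) \<longlonglongrightarrow> m"
      using LIMSEQ_inverse_real_of_nat_add[of m] by (simp add: inverse_eq_divide)
  qed simp
  define rl where "rl = m - (norm pl)\<^sup>2 / 2"
  have rlim: "(\<lambda>n. snd (u n)) \<longlonglongrightarrow> rl"
  proof -
    have "(\<lambda>n. Q (u n) - (norm (p n))\<^sup>2 / 2) \<longlonglongrightarrow> rl"
      unfolding rl_def by (intro tendsto_intros Qlim pl) simp
    then show ?thesis by (simp add: Q_def p_def)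
  qed
  have "(\<lambda>n. (p n, snd (u n))) \<longlonglongrightarrow> (pl, rl)"
    by (intro tendsto_Pair pl rlim)
  then have "(pl, rl) \<in> closure K"
    unfolding closure_sequential using uK by (auto simp: p_def intro!: exI[of _ u])
  moreover have "rl + inner pl pl \<le> s + inner q pl" if "(q, s) \<in> K" for q s
  proof -
    \<comment> \<open>The minimiser is only known to lie in the closure of \<open>K\<close>, so
      \<open>(q, s)\<close> is joined to the points \<open>u n\<close> and the limit in
      \<open>n\<close> is taken. Division by \<open>t\<close> and \<open>t\<close> tending to 0 then
      give the optimality condition.\<close>
    have ineq: "0 \<le> s - rl + inner (q - pl) pl + t * ((norm (q - pl))\<^sup>2 / 2)"
      if t: "0 < t" "t < 1" for t
    proof -
      have "m \<le> Q ((1 - t) *\<^sub>R u n + t *\<^sub>R (q, s))" for n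
        using t \<open>convex K\<close> uK \<open>(q, s) \<in> K\<close> by (intro m_le convexD) auto
      moreover have "(\<lambda>n. Q ((1 - t) *\<^sub>R u n + t *\<^sub>R (q, s)))
          \<longlonglongrightarrow> (1 - t) * rl + t * s + (norm ((1 - t) *\<^sub>R pl + t *\<^sub>R q))\<^sup>2 / 2"
        using pl rlim unfolding Q_def p_def by (auto intro!: tendsto_intros)
      ultimately have "m \<le> (1 - t) * rl + t * s + (norm ((1 - t) *\<^sub>R pl + t *\<^sub>R q))\<^sup>2 / 2"
        by (meson LIMSEQ_le_const)
      moreover have "(1 - t) * rl + t * s + (norm ((1 - t) *\<^sub>R pl + t *\<^sub>R q))\<^sup>2 / 2 - m
          = t * (s - rl + inner (q - pl) pl + t * ((norm (q - pl))\<^sup>2 / 2))"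
        unfolding rl_def power2_norm_eq_inner
        by (simp add: inner_add_left inner_add_right
          inner_diff_left inner_diff_right inner_commute[of q pl] field_simps)
      ultimately have "0 \<le> t * (s - rl + inner (q - pl) pl + t * ((norm (q - pl))\<^sup>2 / 2))"
        by linarith
      then show ?thesis using t by (simp add: zero_le_mult_iff)
    qed
    have "((\<lambda>t. s - rl + inner (q - pl) pl + t * ((norm (q - pl))\<^sup>2 / 2))
       \<longlongrightarrow> s - rl + inner (q - pl) pl + 0 * ((norm (q - pl))\<^sup>2 / 2)) (at_right 0)"
      by (intro tendsto_intros)
    moreover have "\<forall>\<^sub>F t in at_right 0. 0 \<le> s - rl + inner (q - pl) pl + t * ((norm (q - pl))\<^sup>2 / 2)"
      using ineq by (auto simp: eventually_at_right_field intro!: exI[of _ 1])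
    ultimately have "0 \<le> s - rl + inner (q - pl) pl + 0 * ((norm (q - pl))\<^sup>2 / 2)"
      by (intro tendsto_lowerbound[where F = "at_right (0::real)"]) auto
    then show ?thesis by (simp add: inner_diff_left)
  qed
  ultimately show ?thesis using that by blast
qed

section \<open>Maximal monotonicity and Minty's theorem\<close>

text \<open>Adjoining the single pair \<open>(z, w)\<close> to the graph keeps it monotone, so by
  maximality the pair was already there.\<close>

lemma maximal_monotoneD:
  assumes "maximal_monotone T" and "\<And>y v. v \<in> T y \<Longrightarrow> inner (z - y) (w - v) \<ge> 0"
  shows "w \<in> T z"
proof -
  define S where "S = T(z := insert w (T z))"
  have mono: "monotone_operator T"
    using assms(1) by (simp add: maximal_monotone_def)
  have sym: "inner (y - z) (v - w) \<ge> 0" if "v \<in> T y" for y v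
    using assms(2)[OF that] by (metis inner_minus_left inner_minus_right minus_diff_eq minus_minus)
  have "monotone_operator S"
    unfolding monotone_operator_def S_def
    using mono assms(2) sym by (auto simp: monotone_operator_def)
  moreover have "\<forall>x. T x \<subseteq> S x" by (auto simp: S_def)
  ultimately have "S = T" using assms(1) unfolding maximal_monotone_def by blast
  then have "S z = T z" by simp
  then show ?thesis by (auto simp: S_def)
qed

text \<open>Let \<open>p = (y, v)\<close> and \<open>r\<close> minimise \<open>r + \<parallel>p\<parallel>\<^sup>2 / 2\<close> over the closed convex hull of the graph
  points paired with their inner products. Monotonicity gives \<open>inner y v \<le> r\<close> on the hull. The optimality
  condition then makes \<open>(- v, - y)\<close> monotonically related to the graph, and applied to that point
  itself it yields \<open>y = - v\<close>.\<close>

lemma Minty: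
  fixes T :: "'a::{real_inner,complete_space} \<Rightarrow> 'a set"
  assumes mono: "monotone_operator T"
    and max: "\<And>z w. (\<And>y v. v \<in> T y \<Longrightarrow> inner (z - y) (w - v) \<ge> 0) \<Longrightarrow> w \<in> T z"
  shows "\<exists>z. - z \<in> T z"
proof -
  define G where "G = {((y, v), inner y v) | y v. v \<in> T y}"
  define K where "K = convex hull G"
  have conv: "convex {((y, v), r). 0 \<le> r - inner y b - inner a v + c}" for a b :: 'a and c :: real
    unfolding convex_alt
  proof clarsimp
    fix y v r y' v' r' and u :: real
    assume 1: "0 \<le> r - inner y b - inner a v + c" and 2: "0 \<le> r' - inner y' b - inner a v' + c"
      and "0 \<le> u" "u \<le> 1"
    then have "0 \<le> (1 - u) * (r - inner y b - inner a v + c) + u * (r' - inner y' b - inner a v' + c)"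
      by simp
    then show "0 \<le> (1 - u) * r + u * r' - inner ((1 - u) *\<^sub>R y + u *\<^sub>R y') b
       - inner a ((1 - u) *\<^sub>R v + u *\<^sub>R v') + c"
      by (simp add: inner_add_left inner_add_right algebra_simps)
  qed
  \<comment> \<open>For a fixed graph point \<open>(a, b)\<close>, monotonicity is an affine
    inequality in \<open>((y, v), r)\<close> and hence passes to the convex hull.\<close>
  have 1: "0 \<le> r - inner y b - inner a v + inner a b" if "((y, v), r) \<in> K" "b \<in> T a" for y v r a b
  proof -
    have "K \<subseteq> {((y, v), r). 0 \<le> r - inner y b - inner a v + inner a b}"
      unfolding K_def
    proof (rule hull_minimal)
      have "0 \<le> inner (y - a) (v - b)" if "v \<in> T y" for y v
        using mono that \<open>b \<in> T a\<close> by (simp add: monotone_operator_def)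
      then show "G \<subseteq> {((y, v), r). 0 \<le> r - inner y b - inner a v + inner a b}"
        unfolding G_def by (fastforce simp: inner_diff_left inner_diff_right)
    qed (rule conv)
    then show ?thesis using that(1) by blast
  qed
  \<comment> \<open>Fact \<open>1\<close> is also affine in the graph point, so that point too may
    range over the hull. Taking both hull points equal gives twice the claim.\<close>
  have 2: "inner y v \<le> r" if "((y, v), r) \<in> K" for y v r
  proof -
    have "K \<subseteq> {((a, b), c). 0 \<le> c - inner a v - inner y b + r}"
      unfolding K_def
    proof (rule hull_minimal)
      show "G \<subseteq> {((a, b), c). 0 \<le> c - inner a v - inner y b + r}"
        unfolding G_def using 1[OF that] by fastforce
    qed (rule conv)
    then show ?thesis using that by fastforce
  qed
  show ?thesis
  proof (cases "G = {}")
    case True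
    then have "T y = {}" for y by (auto simp: G_def)
    \<comment> \<open>With an empty graph the premise of \<open>max\<close> is vacuous, so 0 lies in
      \<open>T 0\<close>.\<close>
    then show ?thesis using max[of 0 0] by auto
  next
    case False
    have "0 \<le> r + (norm p)\<^sup>2 / 2" if "(p, r) \<in> K" for p r
    proof -
      obtain y v where p: "p = (y, v)" by (cases p)
      have "0 \<le> (norm (y + v))\<^sup>2" by simp
      also have "\<dots> \<le> 2 * r + (norm p)\<^sup>2"
        using 2[of y v r] that by (simp add: p power2_norm_eq_inner inner_add_left inner_add_right
            inner_commute[of v y])
      finally show ?thesis by simp
    qed
    moreover have "convex K" "K \<noteq> {}" using False by (auto simp: K_def)
    ultimately obtain p r where cl: "(p, r) \<in> closure K"
      and opt: "\<And>q s. (q, s) \<in> K \<Longrightarrow> r + inner p p \<le> s + inner q p"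
      using quadratic_epigraph_minimizer[of K] by blast
    obtain y v where p: "p = (y, v)" by (cases p)
    have "closed {u :: ('a \<times> 'a) \<times> real. inner (fst (fst u)) (snd (fst u)) \<le> snd u}"
      by (intro closed_Collect_le continuous_intros)
    moreover have "K \<subseteq> {u. inner (fst (fst u)) (snd (fst u)) \<le> snd u}"
      using 2 by auto
    ultimately have "closure K \<subseteq> {u. inner (fst (fst u)) (snd (fst u)) \<le> snd u}"
      by (rule closure_minimal[rotated])
    then have r: "inner y v \<le> r" using cl p by auto
    have main: "inner y v + inner y y + inner v v \<le> inner a b + inner a y + inner b v"
      if "b \<in> T a" for a b
    proof -
      have "((a, b), inner a b) \<in> K"
        unfolding K_def by (rule hull_inc) (use that in \<open>auto simp: G_def\<close>)
      from opt[OF this] r show ?thesis by (simp add: p)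
    qed
    have sq: "0 \<le> inner (y + v) (y + v)" by simp
    \<comment> \<open>By \<open>main\<close> the pairing with any graph point is at least
      \<open>inner (y + v) (y + v)\<close>.\<close>
    have mem: "- y \<in> T (- v)"
    proof (rule max)
      fix a b assume "b \<in> T a"
      from main[OF this] sq show "0 \<le> inner (- v - a) (- y - b)"
        by (simp add: inner_add_left inner_add_right inner_diff_left inner_diff_right inner_commute)
    qed
    from main[OF this] have "inner (y + v) (y + v) \<le> 0"
      by (simp add: inner_add_left inner_add_right inner_commute)
    then have "y + v = 0" using sq by (metis inner_eq_zero_iff order_antisym)
    then have "y = - v" by (simp add: eq_neg_iff_add_eq_0)
    then show ?thesis using mem by (intro exI[of _ "- v"]) simp
  qed
qed

text \<open>The equation reads \<open>- z \<in> S z\<close> for the scaled and shifted operator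
  \<open>S\<close>, which inherits the hypotheses of \<open>Minty\<close> from
  \<open>T\<close>.\<close>

lemma resolvent_solution_exists:
  fixes T :: "'a::{real_inner,complete_space} \<Rightarrow> 'a set"
  assumes "maximal_monotone T" and "l > 0"
  shows "\<exists>z. \<exists>v\<in>T z. u = l *\<^sub>R v + z"
proof -
  define S where "S z = (\<lambda>v. l *\<^sub>R v - u) ` T z" for z
  have mono: "monotone_operator T" using assms(1) by (simp add: maximal_monotone_def)
  have "\<exists>z. - z \<in> S z"
  proof (rule Minty)
    show "monotone_operator S"
      using mono \<open>l > 0\<close> by (auto simp: monotone_operator_def S_def simp flip: scaleR_diff_right)
    fix z w assume *: "\<And>y v. v \<in> S y \<Longrightarrow> inner (z - y) (w - v) \<ge> 0"
    have "(1 / l) *\<^sub>R (w + u) \<in> T z"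
    proof (rule maximal_monotoneD[OF assms(1)])
      fix y v assume "v \<in> T y"
      then have "inner (z - y) (w - (l *\<^sub>R v - u)) \<ge> 0" by (intro *) (auto simp: S_def)
      moreover have "w - (l *\<^sub>R v - u) = l *\<^sub>R ((1 / l) *\<^sub>R (w + u) - v)"
        using \<open>l > 0\<close> by (simp add: algebra_simps)
      ultimately show "inner (z - y) ((1 / l) *\<^sub>R (w + u) - v) \<ge> 0"
        using \<open>l > 0\<close> by (simp add: zero_le_mult_iff)
    qed
    then show "w \<in> S z"
      using \<open>l > 0\<close> by (force simp: S_def)
  qed
  then obtain z v where "v \<in> T z" "- z = l *\<^sub>R v - u" by (auto simp: S_def)
  then show ?thesis by (metis add_diff_cancel_left' diff_add_cancel diff_minus_eq_add minus_diff_eq)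
qed

section \<open>Projections and resolvents\<close>

text \<open>The variational inequality is the optimality condition for the set translated by
  \<open>- u\<close>. It also bounds \<open>(dist u q)\<^sup>2\<close> below by
  \<open>(dist u P)\<^sup>2 + (dist P q)\<^sup>2\<close>, so the nearest point is unique and the
  definite description in \<open>projection\<close> is justified.\<close>

lemma projection_variational:
  fixes S :: "'a::{real_inner,complete_space} set"
  assumes "closed S" and "convex S" and "S \<noteq> {}"
  shows "projection S u \<in> S"
    and "q \<in> S \<Longrightarrow> inner (u - projection S u) (q - projection S u) \<le> 0"
proof -
  let ?K = "((\<lambda>q. q - u) ` S) \<times> {0::real}"
  have "closed ?K" "convex ?K" "?K \<noteq> {}"
    using assms by (auto intro!: closed_Times closed_translation_subtract convex_Times
        convex_translation_subtract)
  moreover have "0 \<le> r + (norm p)\<^sup>2 / 2" if "(p, r) \<in> ?K" for p r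
    using that by auto
  ultimately obtain p r where pr: "(p, r) \<in> ?K"
    and opt: "\<And>q s. (q, s) \<in> ?K \<Longrightarrow> r + inner p p \<le> s + inner q p"
    using quadratic_epigraph_minimizer[of ?K] unfolding closure_closed[OF \<open>closed ?K\<close>] by blast
  from pr have "p + u \<in> S" "r = 0" by auto
  define P where "P = p + u"
  have P: "P \<in> S" using \<open>p + u \<in> S\<close> by (simp add: P_def)
  have var: "inner (u - P) (q - P) \<le> 0" if "q \<in> S" for q
  proof -
    have "(q - u, 0) \<in> ?K" using that by auto
    from opt[OF this] \<open>r = 0\<close> show ?thesis
      by (simp add: P_def inner_diff_left inner_diff_right inner_add_left inner_add_right inner_commute)
  qed
  have dist_sq: "(dist u q)\<^sup>2 \<ge> (dist u P)\<^sup>2 + (dist P q)\<^sup>2" if "q \<in> S" for q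
    using var[OF that]
    by (simp add: dist_norm power2_norm_eq_inner inner_diff_left inner_diff_right inner_commute)
  have min: "dist u P \<le> dist u q" if "q \<in> S" for q
  proof (rule power2_le_imp_le)
    show "(dist u P)\<^sup>2 \<le> (dist u q)\<^sup>2"
      using dist_sq[OF that] zero_le_power2[of "dist P q"] by linarith
  qed simp
  have "projection S u = P"
    unfolding projection_def
  proof (rule the_equality)
    show "P \<in> S \<and> (\<forall>q\<in>S. dist u P \<le> dist u q)" using P min by blast
    fix p' assume p': "p' \<in> S \<and> (\<forall>q\<in>S. dist u p' \<le> dist u q)"
    then have "(dist u p')\<^sup>2 \<le> (dist u P)\<^sup>2" using P by (intro power_mono) auto
    then have "(dist P p')\<^sup>2 \<le> 0" using dist_sq[of p'] p' by linarith
    then show "p' = P" by simp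
  qed
  then show "projection S u \<in> S"
    and "q \<in> S \<Longrightarrow> inner (u - projection S u) (q - projection S u) \<le> 0"
    using P var by auto
qed

text \<open>Monotonicity gives firm nonexpansiveness,
  \<open>(norm (z - z'))\<^sup>2 \<le> inner (z - z') (u - u')\<close>, and Cauchy-Schwarz finishes.
  The case \<open>u = u'\<close> is uniqueness of the resolvent.\<close>

lemma resolvent_nonexpansive:
  assumes "monotone_operator T" and "l > 0"
    and "v \<in> T z" and "u = l *\<^sub>R v + z" and "v' \<in> T z'" and "u' = l *\<^sub>R v' + z'"
  shows "norm (z - z') \<le> norm (u - u')"
proof -
  have "0 \<le> inner (z - z') (v - v')"
    using assms by (simp add: monotone_operator_def)
  then have "0 \<le> inner (z - z') (l *\<^sub>R (v - v'))" using \<open>l > 0\<close> by simp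
  then have "(norm (z - z'))\<^sup>2 \<le> inner (z - z') (u - u')"
    by (simp add: assms power2_norm_eq_inner inner_diff_right inner_add_right scaleR_diff_right
        algebra_simps)
  also have "\<dots> \<le> norm (z - z') * norm (u - u')" by (rule norm_cauchy_schwarz)
  finally show ?thesis
    by (cases "z = z'") (auto simp: power2_eq_square)
qed

lemma resolvent_solves:
  fixes T :: "'a::{real_inner,complete_space} \<Rightarrow> 'a set"
  assumes "maximal_monotone T" and "l > 0"
  shows "\<exists>v\<in>T (resolvent l T u). u = l *\<^sub>R v + resolvent l T u"
proof -
  have mono: "monotone_operator T" using assms(1) by (simp add: maximal_monotone_def)
  have "\<exists>!z. \<exists>v\<in>T z. u = l *\<^sub>R v + z"
  proof (rule ex_ex1I)
    show "\<exists>z. \<exists>v\<in>T z. u = l *\<^sub>R v + z" using assms by (rule resolvent_solution_exists)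
    fix z z' assume "\<exists>v\<in>T z. u = l *\<^sub>R v + z" "\<exists>v\<in>T z'. u = l *\<^sub>R v + z'"
    then obtain v v' where "v \<in> T z" "u = l *\<^sub>R v + z" "v' \<in> T z'" "u = l *\<^sub>R v' + z'" by blast
    from resolvent_nonexpansive[OF mono \<open>l > 0\<close> this] show "z = z'" by simp
  qed
  then show ?thesis unfolding resolvent_def by (rule theI')
qed

text \<open>Multiplying the inclusion by \<open>\<mu>\<close> and treating \<open>F\<close> explicitly gives a forward-backward
  map \<open>\<Phi>\<close> of \<open>\<Omega>\<close> into itself; it is a contraction for small \<open>\<mu>\<close>, because the identity
  in the implicit part contributes the factor \<open>1 / (1 + \<mu>)\<close>.\<close>

lemma resolvent_sum_solution_exists:
  fixes C :: "'a::{real_inner,complete_space} \<Rightarrow> 'a set" and F :: "'a \<Rightarrow> 'a"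
  assumes C: "maximal_monotone C" "operator_domain C \<subseteq> \<Omega>"
    and \<Omega>: "closed \<Omega>" "\<Omega> \<noteq> {}"
    and mono: "\<And>x y. x \<in> \<Omega> \<Longrightarrow> y \<in> \<Omega> \<Longrightarrow> inner (F x - F y) (x - y) \<ge> 0"
    and lip: "\<And>x y. x \<in> \<Omega> \<Longrightarrow> y \<in> \<Omega> \<Longrightarrow> norm (F x - F y) \<le> K * norm (x - y)"
    and "\<gamma> > 0"
  shows "\<exists>x. \<exists>c\<in>C x. z = \<gamma> *\<^sub>R (c + F x) + x"
proof -
  define \<kappa> where "\<kappa> = \<gamma> * K"
  \<comment> \<open>This choice gives \<open>\<mu> * \<kappa>\<^sup>2 \<le> 1\<close>, hence
    \<open>\<mu>\<^sup>2 * \<kappa>\<^sup>2 < \<mu>\<^sup>2 + 2 * \<mu>\<close>, which is what makes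
    \<open>q < 1\<close>.\<close>
  define \<mu> where "\<mu> = 1 / (1 + \<kappa>\<^sup>2)"
  have pos: "1 + \<kappa>\<^sup>2 > 0" by (simp add: add_pos_nonneg)
  then have "\<mu> > 0" by (simp add: \<mu>_def)
  have "\<mu> * \<kappa>\<^sup>2 \<le> 1" using pos by (simp add: \<mu>_def)
  define l where "l = \<mu> * \<gamma> / (1 + \<mu>)"
  have "l > 0" using \<open>\<mu> > 0\<close> \<open>\<gamma> > 0\<close> by (simp add: l_def)
  \<comment> \<open>With \<open>x\<close> added to both sides of the multiplied inclusion, the
    implicit part becomes \<open>(\<mu> * \<gamma>) *\<^sub>R c + (1 + \<mu>) *\<^sub>R x\<close>.
    Dividing by \<open>1 + \<mu>\<close> leaves a resolvent equation with parameter \<open>l\<close>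
    and right-hand side \<open>U x\<close>.\<close>
  define U where "U x = (1 / (1 + \<mu>)) *\<^sub>R (x - (\<mu> * \<gamma>) *\<^sub>R F x + \<mu> *\<^sub>R z)" for x
  define \<Phi> where "\<Phi> x = resolvent l C (U x)" for x
  have \<Phi>: "\<exists>v\<in>C (\<Phi> x). U x = l *\<^sub>R v + \<Phi> x" for x
    unfolding \<Phi>_def using C(1) \<open>l > 0\<close> by (rule resolvent_solves)
  define q where "q = sqrt (1 + \<mu>\<^sup>2 * \<kappa>\<^sup>2) / (1 + \<mu>)"
  have "\<mu>\<^sup>2 * \<kappa>\<^sup>2 < \<mu>\<^sup>2 + 2 * \<mu>"
  proof -
    have "\<mu>\<^sup>2 * \<kappa>\<^sup>2 = \<mu> * (\<mu> * \<kappa>\<^sup>2)" by (simp add: power2_eq_square)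
    also have "\<dots> \<le> \<mu> * 1" using \<open>\<mu> > 0\<close> \<open>\<mu> * \<kappa>\<^sup>2 \<le> 1\<close> by (intro mult_left_mono) auto
    finally show ?thesis using \<open>\<mu> > 0\<close> zero_le_power2[of \<mu>] by linarith
  qed
  then have "1 + \<mu>\<^sup>2 * \<kappa>\<^sup>2 < (1 + \<mu>)\<^sup>2" by (simp add: power2_sum)
  then have "sqrt (1 + \<mu>\<^sup>2 * \<kappa>\<^sup>2) < 1 + \<mu>"
    using \<open>\<mu> > 0\<close> by (intro real_less_lsqrt) auto
  then have q: "0 \<le> q" "q < 1" using \<open>\<mu> > 0\<close> by (auto simp: q_def)
  have contr: "norm (\<Phi> x - \<Phi> y) \<le> q * norm (x - y)" if "x \<in> \<Omega>" "y \<in> \<Omega>" for x y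
  proof -
    have mC: "monotone_operator C" using C(1) by (simp add: maximal_monotone_def)
    have "norm (\<Phi> x - \<Phi> y) \<le> norm (U x - U y)"
      using resolvent_nonexpansive[OF mC \<open>l > 0\<close>] \<Phi>[of x] \<Phi>[of y] by blast
    also have "U x - U y = (1 / (1 + \<mu>)) *\<^sub>R ((x - y) - (\<mu> * \<gamma>) *\<^sub>R (F x - F y))"
      by (simp add: U_def algebra_simps)
    also have "norm \<dots> = norm ((x - y) - (\<mu> * \<gamma>) *\<^sub>R (F x - F y)) / (1 + \<mu>)"
      using \<open>\<mu> > 0\<close> by simp
    also have "norm ((x - y) - (\<mu> * \<gamma>) *\<^sub>R (F x - F y)) \<le> sqrt (1 + \<mu>\<^sup>2 * \<kappa>\<^sup>2) * norm (x - y)"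
    proof (rule power2_le_imp_le)
      have "(norm ((x - y) - (\<mu> * \<gamma>) *\<^sub>R (F x - F y)))\<^sup>2
          = (norm (x - y))\<^sup>2 - 2 * (\<mu> * \<gamma> * inner (F x - F y) (x - y)) + (\<mu> * \<gamma>)\<^sup>2 * (norm (F x - F y))\<^sup>2"
        by (simp only: power2_norm_eq_inner inner_diff_left[of "x - y"] inner_diff_right[of _ "x - y"]
            inner_scaleR_left inner_scaleR_right inner_commute[of "x - y" "F x - F y"])
          (simp add: power2_eq_square algebra_simps)
      also have "\<dots> \<le> (norm (x - y))\<^sup>2 + (\<mu> * \<gamma>)\<^sup>2 * (K * norm (x - y))\<^sup>2"
      proof -
        have "0 \<le> \<mu> * \<gamma> * inner (F x - F y) (x - y)"
          using mono[OF that] \<open>\<mu> > 0\<close> \<open>\<gamma> > 0\<close> by simp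
        moreover have "(\<mu> * \<gamma>)\<^sup>2 * (norm (F x - F y))\<^sup>2 \<le> (\<mu> * \<gamma>)\<^sup>2 * (K * norm (x - y))\<^sup>2"
          using lip[OF that] by (intro mult_left_mono power_mono) auto
        ultimately show ?thesis by linarith
      qed
      also have "\<dots> = (1 + \<mu>\<^sup>2 * \<kappa>\<^sup>2) * (norm (x - y))\<^sup>2"
        by (simp add: \<kappa>_def power_mult_distrib algebra_simps)
      also have "\<dots> = (sqrt (1 + \<mu>\<^sup>2 * \<kappa>\<^sup>2) * norm (x - y))\<^sup>2"
        by (simp add: power_mult_distrib)
      finally show "(norm ((x - y) - (\<mu> * \<gamma>) *\<^sub>R (F x - F y)))\<^sup>2 \<le> (sqrt (1 + \<mu>\<^sup>2 * \<kappa>\<^sup>2) * norm (x - y))\<^sup>2" .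
    qed simp
    finally show ?thesis using \<open>\<mu> > 0\<close> by (simp add: q_def divide_right_mono)
  qed
  have "\<Phi> ` \<Omega> \<subseteq> \<Omega>" using \<Phi> C(2) by (auto simp: operator_domain_def)
  then have "\<exists>!x\<in>\<Omega>. \<Phi> x = x"
    using \<Omega> q contr by (intro Banach_fix[of _ q]) (auto simp: complete_eq_closed dist_norm)
  then obtain x where "\<Phi> x = x" by blast
  with \<Phi>[of x] obtain c where c: "c \<in> C x" "U x = l *\<^sub>R c + x" by auto
  have "(1 + \<mu>) *\<^sub>R U x = (1 + \<mu>) *\<^sub>R (l *\<^sub>R c + x)" by (simp add: c)
  then have "x - (\<mu> * \<gamma>) *\<^sub>R F x + \<mu> *\<^sub>R z = (\<mu> * \<gamma>) *\<^sub>R c + (1 + \<mu>) *\<^sub>R x"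
    using \<open>\<mu> > 0\<close> by (simp add: U_def l_def scaleR_add_right[of "1 + \<mu>"])
  then have "\<mu> *\<^sub>R z = \<mu> *\<^sub>R (\<gamma> *\<^sub>R (c + F x) + x)"
    by (simp add: algebra_simps)
  then have "z = \<gamma> *\<^sub>R (c + F x) + x" using \<open>\<mu> > 0\<close> by simp
  then show ?thesis using c by blast
qed

subsection \<open>The inner algorithm\<close>

lemma mem_plus_singletons: "u \<in> X + {a} + {b} \<longleftrightarrow> (\<exists>c\<in>X. u = c + a + b)"
  by (auto simp: set_plus_def)

lemma norm_add_squared: "(norm (u + v))\<^sup>2 = (norm u)\<^sup>2 + 2 * inner u v + (norm v)\<^sup>2"
  for u v :: "'a::real_inner"
  unfolding power2_norm_eq_inner
  by (simp add: inner_add_left inner_add_right inner_commute[of v u])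

lemma norm_diff_squared: "(norm (u - v))\<^sup>2 = (norm u)\<^sup>2 - 2 * inner u v + (norm v)\<^sup>2"
  for u v :: "'a::real_inner"
  using norm_add_squared[of u "- v"] by simp

locale tseng_splitting =
  fixes C :: "'a::{real_inner,complete_space} \<Rightarrow> 'a set"
    and \<Omega> :: "'a set" and F1 F2 :: "'a \<Rightarrow> 'a" and L \<eta> \<sigma> \<gamma> :: real
  assumes C_maximal: "maximal_monotone C"
    and \<Omega>_nonempty: "\<Omega> \<noteq> {}" and \<Omega>_closed: "closed \<Omega>" and \<Omega>_convex: "convex \<Omega>"
    and domain_C: "operator_domain C \<subseteq> \<Omega>"
    and F1_monotone: "\<And>z z'. z \<in> \<Omega> \<Longrightarrow> z' \<in> \<Omega> \<Longrightarrow> inner (F1 z - F1 z') (z - z') \<ge> 0"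
    and F1_lipschitz: "\<And>z z'. z \<in> \<Omega> \<Longrightarrow> z' \<in> \<Omega> \<Longrightarrow> norm (F1 z - F1 z') \<le> L * norm (z - z')"
    and \<eta>_pos: "\<eta> > 0"
    and F2_cocoercive: "\<And>z z'. inner (F2 z - F2 z') (z - z') \<ge> \<eta> * (norm (F2 z - F2 z'))\<^sup>2"
    and \<sigma>_pos: "0 < \<sigma>" and \<sigma>_less_1: "\<sigma> < 1"
    and \<gamma>_pos: "0 < \<gamma>"
    and \<gamma>_le: "\<gamma> \<le> 4 * \<eta> * \<sigma>\<^sup>2 / (1 + sqrt (1 + 16 * L\<^sup>2 * \<eta>\<^sup>2 * \<sigma>\<^sup>2))"
begin

section \<open>The operator \<open>B\<close>, its enlargement and its resolvent\<close>

abbreviation B :: "'a \<Rightarrow> 'a set" where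
  "B \<equiv> \<lambda>x. C x + {F1 x} + {F2 x}"

text \<open>Only the cocoercive summand is enlarged: an inner step delivers \<open>C\<close> and
  \<open>F1\<close> exactly at the new point, but \<open>F2\<close> at the old projected
  one.\<close>

abbreviation B_enl :: "real \<Rightarrow> 'a \<Rightarrow> 'a set" where
  "B_enl e x \<equiv> C x + {F1 x} + enlargement e (\<lambda>z. {F2 z}) x"

lemma C_monotone: "u \<in> C x \<Longrightarrow> v \<in> C y \<Longrightarrow> inner (x - y) (u - v) \<ge> 0"
  using C_maximal by (simp add: maximal_monotone_def monotone_operator_def)

lemma mem_domain: "c \<in> C x \<Longrightarrow> x \<in> \<Omega>"
  using domain_C by (auto simp: operator_domain_def)

text \<open>The upper bound on \<open>\<gamma>\<close> is the positive root of \<open>L\<^sup>2 \<gamma>\<^sup>2 + \<gamma> / (2 \<eta>) = \<sigma>\<^sup>2\<close>.\<close>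

lemma step_size: "(\<gamma> * L)\<^sup>2 + \<gamma> / (2 * \<eta>) \<le> \<sigma>\<^sup>2"
proof -
  define s where "s = sqrt (1 + 16 * L\<^sup>2 * \<eta>\<^sup>2 * \<sigma>\<^sup>2)"
  have s2: "s\<^sup>2 = 1 + 16 * L\<^sup>2 * \<eta>\<^sup>2 * \<sigma>\<^sup>2" by (simp add: s_def)
  have "s \<ge> 1" by (simp add: s_def)
  have \<gamma>s: "\<gamma> * (1 + s) \<le> 4 * \<eta> * \<sigma>\<^sup>2"
    using \<gamma>_le \<open>s \<ge> 1\<close> by (simp add: s_def[symmetric] pos_le_divide_eq)
  \<comment> \<open>The factorisation \<open>s\<^sup>2 - 1 = (1 + s) * (s - 1)\<close> brings in
    \<open>\<gamma>s\<close>; the common factor \<open>4 * \<eta> * \<sigma>\<^sup>2\<close> then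
    cancels.\<close>
  have "(4 * \<eta> * \<sigma>\<^sup>2) * (4 * \<eta> * (\<gamma> * L)\<^sup>2) = \<gamma>\<^sup>2 * (s\<^sup>2 - 1)"
    unfolding s2 by (simp add: power2_eq_square algebra_simps)
  also have "\<dots> = (\<gamma> * (1 + s)) * (\<gamma> * (s - 1))"
    by (simp add: power2_eq_square algebra_simps)
  also have "\<dots> \<le> (4 * \<eta> * \<sigma>\<^sup>2) * (\<gamma> * (s - 1))"
    using \<gamma>s \<open>s \<ge> 1\<close> \<gamma>_pos by (intro mult_right_mono) auto
  finally have "4 * \<eta> * (\<gamma> * L)\<^sup>2 \<le> \<gamma> * (s - 1)"
    using \<eta>_pos \<sigma>_pos by simp
  then have "4 * \<eta> * (\<gamma> * L)\<^sup>2 + 2 * \<gamma> \<le> 4 * \<eta> * \<sigma>\<^sup>2"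
    using \<gamma>s by (simp add: algebra_simps)
  then show ?thesis using \<eta>_pos by (simp add: field_simps)
qed

text \<open>Completing the square gives \<open>inner e d + \<eta> * (norm d)\<^sup>2 \<ge> - (norm
  e)\<^sup>2 / (4 * \<eta>)\<close>, and cocoercivity bounds
  \<open>\<eta> * (norm d)\<^sup>2\<close> by \<open>inner (w - z) d\<close>.\<close>

lemma F2_enlargement: "F2 w \<in> enlargement ((norm (w - x))\<^sup>2 / (4 * \<eta>)) (\<lambda>z. {F2 z}) x"
proof -
  have "- ((norm (w - x))\<^sup>2 / (4 * \<eta>)) \<le> inner (x - z) (F2 w - F2 z)" for z
  proof -
    define e where "e = x - w"
    define d where "d = F2 w - F2 z"
    have "0 \<le> (norm (e + (2 * \<eta>) *\<^sub>R d))\<^sup>2" by simp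
    also have "\<dots> = (norm e)\<^sup>2 + 4 * \<eta> * (inner e d + \<eta> * (norm d)\<^sup>2)"
      by (simp add: norm_add_squared power_mult_distrib power2_eq_square[of \<eta>] algebra_simps)
    also have "\<dots> \<le> (norm e)\<^sup>2 + 4 * \<eta> * (inner e d + inner (w - z) d)"
      using F2_cocoercive[of w z] \<eta>_pos by (simp add: d_def inner_commute)
    also have "inner e d + inner (w - z) d = inner (x - z) d"
      by (simp add: e_def flip: inner_add_left)
    finally show ?thesis
      using \<eta>_pos by (simp add: e_def d_def field_simps norm_minus_commute)
  qed
  then show ?thesis by (simp add: enlargement_def)
qed

lemma B_enl_monotone:
  assumes "b \<in> B_enl e x" and "b' \<in> B x'"
  shows "inner (x - x') (b - b') \<ge> - e"
proof -
  obtain c v where c: "c \<in> C x" "v \<in> enlargement e (\<lambda>z. {F2 z}) x" "b = c + F1 x + v"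
    using assms(1) by (auto simp: set_plus_def)
  obtain c' where c': "c' \<in> C x'" "b' = c' + F1 x' + F2 x'"
    using assms(2) by (auto simp: mem_plus_singletons)
  have "inner (x - x') (c - c') \<ge> 0" using c c' by (intro C_monotone)
  moreover have "inner (x - x') (F1 x - F1 x') \<ge> 0"
    using F1_monotone mem_domain[OF c(1)] mem_domain[OF c'(1)] by (simp add: inner_commute)
  moreover have "inner (x - x') (v - F2 x') \<ge> - e" using c(2) by (simp add: enlargement_def)
  moreover have "b - b' = (c - c') + (F1 x - F1 x') + (v - F2 x')" by (simp add: c c')
  ultimately show ?thesis by (simp add: inner_add_right)
qed

lemma B_monotone:
  assumes "b \<in> B x" and "b' \<in> B x'"
  shows "inner (x - x') (b - b') \<ge> 0"
proof -
  have "F2 x \<in> enlargement 0 (\<lambda>z. {F2 z}) x" using F2_enlargement[of x x] by simp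
  then have "b \<in> B_enl 0 x" using assms(1) by (auto simp: set_plus_def)
  from B_enl_monotone[OF this assms(2)] show ?thesis by simp
qed

text \<open>Cocoercivity makes \<open>F2\<close> monotone and Lipschitz with constant
  \<open>1 / \<eta>\<close>, so \<open>F1 + F2\<close> can be treated as one monotone Lipschitz map
  on \<Omega>. The solution \<open>x\<close> is the limit of the inner iterates.\<close>

lemma resolvent_B_exists: "\<exists>x. \<exists>b\<in>B x. z = \<gamma> *\<^sub>R b + x"
proof -
  have lip2: "norm (F2 x - F2 y) \<le> (1 / \<eta>) * norm (x - y)" for x y
  proof -
    have "\<eta> * (norm (F2 x - F2 y))\<^sup>2 \<le> norm (F2 x - F2 y) * norm (x - y)"
      using F2_cocoercive[of x y] norm_cauchy_schwarz order_trans by blast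
    then have "\<eta> * norm (F2 x - F2 y) \<le> norm (x - y)"
      by (cases "F2 x = F2 y") (auto simp: power2_eq_square)
    then show ?thesis using \<eta>_pos by (simp add: field_simps)
  qed
  have "\<exists>x. \<exists>c\<in>C x. z = \<gamma> *\<^sub>R (c + (F1 x + F2 x)) + x"
  proof (rule resolvent_sum_solution_exists[OF C_maximal domain_C \<Omega>_closed \<Omega>_nonempty _ _ \<gamma>_pos])
    fix x y assume xy: "x \<in> \<Omega>" "y \<in> \<Omega>"
    have eq: "F1 x + F2 x - (F1 y + F2 y) = (F1 x - F1 y) + (F2 x - F2 y)" by simp
    have "inner (F2 x - F2 y) (x - y) \<ge> 0"
      using F2_cocoercive[of x y] \<eta>_pos by (meson order_trans mult_nonneg_nonneg less_imp_le zero_le_power2)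
    then show "inner (F1 x + F2 x - (F1 y + F2 y)) (x - y) \<ge> 0"
      unfolding eq inner_add_left using F1_monotone[OF xy] by (rule add_nonneg_nonneg[rotated])
    have "norm (F1 x + F2 x - (F1 y + F2 y)) \<le> norm (F1 x - F1 y) + norm (F2 x - F2 y)"
      by (rule norm_diff_triangle_ineq)
    then show "norm (F1 x + F2 x - (F1 y + F2 y)) \<le> (L + 1 / \<eta>) * norm (x - y)"
      using F1_lipschitz[OF xy] lip2[of x y] by (simp add: distrib_right)
  qed
  then obtain x c where "c \<in> C x" "z = \<gamma> *\<^sub>R (c + (F1 x + F2 x)) + x" by blast
  then show ?thesis by (intro exI[of _ x] bexI[of _ "c + F1 x + F2 x"])
      (auto simp: mem_plus_singletons add.assoc)
qed

text \<open>Monotonicity between \<open>(x, b)\<close> and \<open>(p, 0)\<close> makes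
  \<open>inner (x - p) (z - x)\<close> nonnegative. This turns a distance to zeros of
  \<open>B\<close> into an initial error for the inner algorithm.\<close>

lemma norm_diff_resolvent_B_le:
  assumes "b \<in> B x" and "z = \<gamma> *\<^sub>R b + x" and "0 \<in> B p"
  shows "norm (z - x) \<le> norm (z - p)"
proof (rule power2_le_imp_le)
  have "0 \<le> inner (x - p) (\<gamma> *\<^sub>R b)"
    using B_monotone[OF assms(1,3)] \<gamma>_pos by simp
  also have "\<gamma> *\<^sub>R b = z - x" by (simp add: assms(2))
  finally have "0 \<le> inner (x - p) (z - x)" .
  moreover have "(norm (z - p))\<^sup>2 = (norm (z - x))\<^sup>2 + 2 * inner (x - p) (z - x) + (norm (x - p))\<^sup>2"
    using norm_add_squared[of "z - x" "x - p"] by (simp add: inner_commute)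
  ultimately show "(norm (z - x))\<^sup>2 \<le> (norm (z - p))\<^sup>2"
    using zero_le_power2[of "norm (x - p)"] by linarith
qed simp

lemma one_minus_\<sigma>2_bounds: "0 < 1 - \<sigma>\<^sup>2" "1 - \<sigma>\<^sup>2 < 1"
  using \<sigma>_pos \<sigma>_less_1 by (simp_all add: power_less_one_iff)

section \<open>A single inner step from \<open>w\<close> to \<open>wn\<close>\<close>

context
  fixes z w w' wt wn :: 'a
  assumes w': "w' = projection \<Omega> w"
    and wt: "wt = resolvent (\<gamma> / 2) C ((1 / 2) *\<^sub>R (z + w - \<gamma> *\<^sub>R (F1 w' + F2 w')))"
    and wn: "wn = wt - \<gamma> *\<^sub>R (F1 wt - F1 w')"
begin

text \<open>Doubling the resolvent equation gives \<open>z + w - 2 *\<^sub>R wt\<close> with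
  \<open>F1\<close> at \<open>w'\<close>. The correction defining \<open>wn\<close> moves
  \<open>F1\<close> to \<open>wt\<close> and replaces one copy of \<open>wt\<close> by
  \<open>wn\<close>.\<close>

lemma backward_point:
  obtains c where "c \<in> C wt" and "\<gamma> *\<^sub>R (c + F1 wt + F2 w') = z + w - (wn + wt)"
proof -
  have "\<exists>v\<in>C wt. (1 / 2) *\<^sub>R (z + w - \<gamma> *\<^sub>R (F1 w' + F2 w')) = (\<gamma> / 2) *\<^sub>R v + wt"
    unfolding wt by (rule resolvent_solves[OF C_maximal]) (use \<gamma>_pos in simp)
  then obtain c where c: "c \<in> C wt"
    "(1 / 2) *\<^sub>R (z + w - \<gamma> *\<^sub>R (F1 w' + F2 w')) = (\<gamma> / 2) *\<^sub>R c + wt" by blast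
  have "2 *\<^sub>R ((1 / 2) *\<^sub>R (z + w - \<gamma> *\<^sub>R (F1 w' + F2 w'))) = 2 *\<^sub>R ((\<gamma> / 2) *\<^sub>R c + wt)"
    by (simp only: c)
  then have "z + w - \<gamma> *\<^sub>R (F1 w' + F2 w') = \<gamma> *\<^sub>R c + 2 *\<^sub>R wt"
    by (simp add: scaleR_add_right)
  then have "z + w = \<gamma> *\<^sub>R (F1 w' + F2 w') + \<gamma> *\<^sub>R c + 2 *\<^sub>R wt"
    by (simp add: algebra_simps)
  then have "\<gamma> *\<^sub>R (c + F1 wt + F2 w') = z + w - (wn + wt)"
    by (simp add: wn algebra_simps scaleR_2)
  with c show ?thesis using that by blast
qed

lemma backward_point_mem: "wt \<in> \<Omega>" "w' \<in> \<Omega>"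
proof -
  show "wt \<in> \<Omega>" by (rule backward_point) (rule mem_domain)
  show "w' \<in> \<Omega>" unfolding w' by (rule projection_variational(1)[OF \<Omega>_closed \<Omega>_convex \<Omega>_nonempty])
qed

lemma tseng_step_mem:
  "(1 / \<gamma>) *\<^sub>R (z + w - (wn + wt)) \<in> B_enl ((norm (w' - wt))\<^sup>2 / (4 * \<eta>)) wt"
proof -
  obtain c where c: "c \<in> C wt" "\<gamma> *\<^sub>R (c + F1 wt + F2 w') = z + w - (wn + wt)"
    by (rule backward_point)
  have "(1 / \<gamma>) *\<^sub>R (z + w - (wn + wt)) = c + F1 wt + F2 w'"
    using \<gamma>_pos by (simp flip: c(2))
  then show ?thesis using c(1) F2_enlargement[of w' wt] by (auto simp: set_plus_def)
qed

text \<open>The Lipschitz bound and \<open>step_size\<close> control the left side by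
  \<open>\<sigma>\<^sup>2 * (norm (w' - wt))\<^sup>2\<close>. Since \<open>wt\<close> lies in
  \<Omega>, projecting \<open>w\<close> does not increase its distance to \<open>wt\<close>.\<close>

lemma tseng_error_le:
  "(norm (wt - wn))\<^sup>2 + \<gamma> * (norm (w' - wt))\<^sup>2 / (2 * \<eta>) \<le> \<sigma>\<^sup>2 * (norm (w - wt))\<^sup>2"
proof -
  note mem = backward_point_mem
  have "norm (wt - wn) = \<gamma> * norm (F1 w' - F1 wt)"
    using \<gamma>_pos by (simp add: wn norm_minus_commute)
  also have "\<dots> \<le> \<gamma> * (L * norm (w' - wt))"
    using \<gamma>_pos F1_lipschitz[OF mem(2,1)] by simp
  finally have "(norm (wt - wn))\<^sup>2 \<le> (\<gamma> * (L * norm (w' - wt)))\<^sup>2"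
    by (intro power_mono) auto
  also have "\<dots> = (\<gamma> * L)\<^sup>2 * (norm (w' - wt))\<^sup>2" by (simp add: power_mult_distrib)
  finally have "(norm (wt - wn))\<^sup>2 + \<gamma> * (norm (w' - wt))\<^sup>2 / (2 * \<eta>)
      \<le> ((\<gamma> * L)\<^sup>2 + \<gamma> / (2 * \<eta>)) * (norm (w' - wt))\<^sup>2"
    by (simp add: distrib_right)
  also have "\<dots> \<le> \<sigma>\<^sup>2 * (norm (w' - wt))\<^sup>2"
    by (intro mult_right_mono step_size) simp
  also have "\<dots> \<le> \<sigma>\<^sup>2 * (norm (w - wt))\<^sup>2"
  proof (intro mult_left_mono)
    have "inner (w - w') (wt - w') \<le> 0"
      unfolding w' by (rule projection_variational(2)[OF \<Omega>_closed \<Omega>_convex \<Omega>_nonempty])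
        (rule mem(1))
    moreover have "(norm (w - wt))\<^sup>2
        = (norm (w - w'))\<^sup>2 - 2 * inner (w - w') (wt - w') + (norm (w' - wt))\<^sup>2"
      using norm_diff_squared[of "w - w'" "wt - w'"] by (simp add: norm_minus_commute)
    ultimately show "(norm (w' - wt))\<^sup>2 \<le> (norm (w - wt))\<^sup>2"
      using zero_le_power2[of "norm (w - w')"] by linarith
  qed simp
  finally show ?thesis .
qed

text \<open>Approximate monotonicity of \<open>B\<close> at \<open>wt\<close> against the solution
  \<open>x\<close> is combined with \<open>tseng_error_le\<close>, whose left side absorbs both the
  enlargement error and the correction \<open>wt - wn\<close>.\<close>

lemma tseng_step_fejer:
  assumes "b \<in> B x" and "z = \<gamma> *\<^sub>R b + x"
  shows "(norm (wn - x))\<^sup>2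
    \<le> (norm (w - x))\<^sup>2 - 2 * (norm (wt - x))\<^sup>2 - (1 - \<sigma>\<^sup>2) * (norm (w - wt))\<^sup>2"
proof -
  define a e f where "a = wt - x" and "e = w - wt" and "f = wt - wn"
  have eqs: "wt - x = a" "w - wt = e" "w - x = a + e" "wn - x = a - f" "wt - wn = f"
    by (simp_all add: a_def e_def f_def)
  let ?\<epsilon> = "(norm (w' - wt))\<^sup>2 / (4 * \<eta>)"
  have "inner (wt - x) ((1 / \<gamma>) *\<^sub>R (z + w - (wn + wt)) - b) \<ge> - ?\<epsilon>"
    by (rule B_enl_monotone[OF tseng_step_mem assms(1)])
  then have "\<gamma> * inner (wt - x) ((1 / \<gamma>) *\<^sub>R (z + w - (wn + wt)) - b) \<ge> \<gamma> * - ?\<epsilon>"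
    using \<gamma>_pos by (intro mult_left_mono) auto
  also have "\<gamma> * inner (wt - x) ((1 / \<gamma>) *\<^sub>R (z + w - (wn + wt)) - b)
      = inner a (\<gamma> *\<^sub>R ((1 / \<gamma>) *\<^sub>R (z + w - (wn + wt)) - b))"
    by (simp add: a_def)
  \<comment> \<open>The term \<open>- a\<close> comes from the identity in the equation for
    \<open>x\<close>; this strong monotonicity produces
    \<open>2 * (norm (wt - x))\<^sup>2\<close>.\<close>
  also have "\<gamma> *\<^sub>R ((1 / \<gamma>) *\<^sub>R (z + w - (wn + wt)) - b) = e + f - a"
    using \<gamma>_pos by (simp add: scaleR_diff_right assms(2) a_def e_def f_def)
  finally have "inner a (e + f - a) \<ge> - (\<gamma> * ?\<epsilon>)" by simp
  moreover have "(norm (a - f))\<^sup>2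
      = (norm (a + e))\<^sup>2 - 2 * inner a (e + f - a) - 2 * (norm a)\<^sup>2 + (norm f)\<^sup>2 - (norm e)\<^sup>2"
    unfolding norm_add_squared norm_diff_squared
    by (simp add: inner_add_right inner_diff_right flip: power2_norm_eq_inner)
  moreover have "(norm f)\<^sup>2 + 2 * (\<gamma> * ?\<epsilon>) \<le> \<sigma>\<^sup>2 * (norm e)\<^sup>2"
    using tseng_error_le by (simp add: eqs)
  ultimately show ?thesis unfolding eqs by (simp add: left_diff_distrib)
qed

text \<open>The gap \<open>2 (1 - \<sigma>\<^sup>2) / (3 - \<sigma>\<^sup>2)\<close> is the minimum of \<open>2 p\<^sup>2 + (1 - \<sigma>\<^sup>2) q\<^sup>2\<close> subject to \<open>p + q = 1\<close>.\<close>

lemma tseng_step_contraction: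
  assumes "b \<in> B x" and "z = \<gamma> *\<^sub>R b + x"
  shows "(norm (wn - x))\<^sup>2 \<le> (1 - 2 * (1 - \<sigma>\<^sup>2) / (3 - \<sigma>\<^sup>2)) * (norm (w - x))\<^sup>2"
proof -
  define s where "s = 1 - \<sigma>\<^sup>2"
  have "s > 0" using one_minus_\<sigma>2_bounds by (simp add: s_def)
  define p q where "p = norm (wt - x)" and "q = norm (w - wt)"
  have "norm (w - x) \<le> p + q"
    unfolding p_def q_def using norm_triangle_ineq[of "wt - x" "w - wt"] by simp
  then have "2 * s * (norm (w - x))\<^sup>2 \<le> 2 * s * (p + q)\<^sup>2"
    using \<open>s > 0\<close> by (intro mult_left_mono power_mono) auto
  \<comment> \<open>The discarded square vanishes when \<open>2 * p = s * q\<close>, the minimising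
    ratio.\<close>
  also have "\<dots> = (2 + s) * (2 * p\<^sup>2 + s * q\<^sup>2) - (2 * p - s * q)\<^sup>2"
    by (simp add: power2_eq_square algebra_simps)
  also have "\<dots> \<le> (2 + s) * (2 * p\<^sup>2 + s * q\<^sup>2)" by simp
  finally have "2 * s / (2 + s) * (norm (w - x))\<^sup>2 \<le> 2 * p\<^sup>2 + s * q\<^sup>2"
    using \<open>s > 0\<close> by (simp add: field_simps)
  moreover have "2 * s / (2 + s) = 2 * (1 - \<sigma>\<^sup>2) / (3 - \<sigma>\<^sup>2)" by (simp add: s_def)
  ultimately show ?thesis
    using tseng_step_fejer[OF assms] by (simp add: left_diff_distrib p_def q_def s_def)
qed

text \<open>The left side is the stopping quantity. By \<open>tseng_error_le\<close> it is at most
  \<open>4 * (norm (w - wt))\<^sup>2\<close>, and \<open>tseng_step_fejer\<close> bounds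
  \<open>(1 - \<sigma>\<^sup>2) * (norm (w - wt))\<^sup>2\<close> by the squared error.\<close>

lemma tseng_step_residual:
  assumes "b \<in> B x" and "z = \<gamma> *\<^sub>R b + x"
  shows "(norm (w - wn))\<^sup>2 + \<gamma> * (norm (w' - wt))\<^sup>2 / (2 * \<eta>) \<le> 4 / (1 - \<sigma>\<^sup>2) * (norm (w - x))\<^sup>2"
proof -
  define q \<delta> where "q = norm (w - wt)" and "\<delta> = norm (wt - wn)"
  have "norm (w - wn) \<le> q + \<delta>"
    unfolding q_def \<delta>_def using norm_triangle_ineq[of "w - wt" "wt - wn"] by simp
  then have "(norm (w - wn))\<^sup>2 \<le> (q + \<delta>)\<^sup>2" by (intro power_mono) auto
  also have "\<dots> = 2 * q\<^sup>2 + 2 * \<delta>\<^sup>2 - (q - \<delta>)\<^sup>2" by (simp add: power2_eq_square algebra_simps)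
  also have "\<dots> \<le> 2 * q\<^sup>2 + 2 * \<delta>\<^sup>2" by simp
  finally have 1: "(norm (w - wn))\<^sup>2 \<le> 2 * q\<^sup>2 + 2 * \<delta>\<^sup>2" .
  have 2: "\<delta>\<^sup>2 + \<gamma> * (norm (w' - wt))\<^sup>2 / (2 * \<eta>) \<le> \<sigma>\<^sup>2 * q\<^sup>2"
    using tseng_error_le by (simp add: q_def \<delta>_def)
  have 3: "\<sigma>\<^sup>2 * q\<^sup>2 \<le> q\<^sup>2"
    using one_minus_\<sigma>2_bounds by (intro mult_left_le_one_le) auto
  have 4: "0 \<le> \<gamma> * (norm (w' - wt))\<^sup>2 / (2 * \<eta>)" using \<gamma>_pos \<eta>_pos by simp
  have 5: "(1 - \<sigma>\<^sup>2) * q\<^sup>2 \<le> (norm (w - x))\<^sup>2"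
    using tseng_step_fejer[OF assms] zero_le_power2[of "norm (wn - x)"]
      zero_le_power2[of "norm (wt - x)"] unfolding q_def by linarith
  have "(norm (w - wn))\<^sup>2 + \<gamma> * (norm (w' - wt))\<^sup>2 / (2 * \<eta>) \<le> 4 * q\<^sup>2"
    using 1 2 3 4 by linarith
  also have "\<dots> \<le> 4 / (1 - \<sigma>\<^sup>2) * (norm (w - x))\<^sup>2"
    using 5 one_minus_\<sigma>2_bounds(1) by (simp add: field_simps)
  finally show ?thesis .
qed

end

section \<open>Linear convergence and termination of the inner algorithm\<close>

abbreviation tseng_seq :: "'a \<Rightarrow> nat \<Rightarrow> 'a tseng_state" where
  "tseng_seq \<equiv> tseng C \<Omega> F1 F2 \<gamma>"

abbreviation contraction_gap :: real where
  "contraction_gap \<equiv> 2 * (1 - \<sigma>\<^sup>2) / (3 - \<sigma>\<^sup>2)"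

lemma tseng_seq_Suc:
  fixes z j
  defines "s \<equiv> tseng_seq z (Suc j)"
  shows "w_prev s = w_next (tseng_seq z j)"
    and "w_proj s = projection \<Omega> (w_prev s)"
    and "w_tilde s = resolvent (\<gamma> / 2) C
          ((1 / 2) *\<^sub>R (z + w_prev s - \<gamma> *\<^sub>R (F1 (w_proj s) + F2 (w_proj s))))"
    and "w_next s = w_tilde s - \<gamma> *\<^sub>R (F1 (w_tilde s) - F1 (w_proj s))"
  by (simp_all add: s_def Let_def)

lemma n_F2_tseng_seq: "n_F2 (tseng_seq z j) = j"
  by (induction j) (simp_all add: Let_def)

lemma contraction_gap_bounds: "0 < contraction_gap" "contraction_gap < 1"
  using one_minus_\<sigma>2_bounds by (auto simp: divide_less_eq add_nonneg_pos)

lemma tseng_linear_convergence: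
  assumes "b \<in> B x" and "z = \<gamma> *\<^sub>R b + x"
  shows "(norm (w_next (tseng_seq z j) - x))\<^sup>2 \<le> (1 - contraction_gap) ^ j * (norm (z - x))\<^sup>2"
proof (induction j)
  case 0
  then show ?case by simp
next
  case (Suc j)
  let ?s = "tseng_seq z (Suc j)"
  have "(norm (w_next ?s - x))\<^sup>2 \<le> (1 - contraction_gap) * (norm (w_prev ?s - x))\<^sup>2"
    by (rule tseng_step_contraction[OF tseng_seq_Suc(2-4) assms])
  also have "\<dots> \<le> (1 - contraction_gap) * ((1 - contraction_gap) ^ j * (norm (z - x))\<^sup>2)"
    unfolding tseng_seq_Suc(1) using Suc contraction_gap_bounds by (intro mult_left_mono) simp_all
  finally show ?case by (simp only: power_Suc mult.assoc)
qed

text \<open>The stopping quantity of iteration \<open>Suc j\<close> is controlled by the error after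
  \<open>j\<close> iterations, and \<open>1 - \<alpha> \<le> exp (- \<alpha>)\<close> makes it at
  most \<tau> once \<open>\<alpha> * j\<close> reaches \<open>ln X\<close>. The summand 2 pays for
  rounding \<open>j\<close> up and for this index shift.\<close>

lemma tseng_terminates:
  assumes "b \<in> B x" and "z = \<gamma> *\<^sub>R b + x" and "norm (z - x) \<le> D" and "0 < D" and "0 < \<tau>"
  shows "\<exists>n\<ge>1. tseng_iterations C \<Omega> F1 F2 \<eta> \<gamma> z \<tau> = enat n \<and> tseng_stop \<gamma> \<eta> \<tau> (tseng_seq z n) \<and>
    real n \<le> 2 + max 0 (ln (4 * D\<^sup>2 / ((1 - \<sigma>\<^sup>2) * \<tau>))) / contraction_gap"
proof -
  define X where "X = 4 * D\<^sup>2 / ((1 - \<sigma>\<^sup>2) * \<tau>)"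
  have "X > 0" using assms one_minus_\<sigma>2_bounds by (simp add: X_def)
  define \<alpha> where "\<alpha> = contraction_gap"
  have \<alpha>: "0 < \<alpha>" "\<alpha> < 1" unfolding \<alpha>_def by (fact contraction_gap_bounds)+
  define stop where "stop j \<longleftrightarrow> 1 \<le> j \<and> tseng_stop \<gamma> \<eta> \<tau> (tseng_seq z j)" for j
  define j where "j = nat \<lceil>max 0 (ln X) / \<alpha>\<rceil>"
  have j_ge: "max 0 (ln X) / \<alpha> \<le> real j" unfolding j_def by (rule real_nat_ceiling_ge)
  have j_le: "real j \<le> 1 + max 0 (ln X) / \<alpha>"
    unfolding j_def using \<alpha> by (simp add: of_nat_nat ceiling_correct) linarith
  let ?s = "tseng_seq z (Suc j)"
  have "(norm (w_prev ?s - w_next ?s))\<^sup>2 + \<gamma> * (norm (w_proj ?s - w_tilde ?s))\<^sup>2 / (2 * \<eta>)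
      \<le> 4 / (1 - \<sigma>\<^sup>2) * (norm (w_prev ?s - x))\<^sup>2"
    by (rule tseng_step_residual[OF tseng_seq_Suc(2-4) assms(1,2)])
  also have "\<dots> \<le> 4 / (1 - \<sigma>\<^sup>2) * (exp (- ln X) * D\<^sup>2)"
  proof (rule mult_left_mono)
    have "(norm (w_prev ?s - x))\<^sup>2 \<le> (1 - \<alpha>) ^ j * (norm (z - x))\<^sup>2"
      unfolding tseng_seq_Suc(1) \<alpha>_def by (rule tseng_linear_convergence[OF assms(1,2)])
    also have "\<dots> \<le> exp (- \<alpha>) ^ j * D\<^sup>2"
      using \<alpha> exp_ge_add_one_self[of "- \<alpha>"] assms(3) by (intro mult_mono power_mono) auto
    also have "\<dots> \<le> exp (- ln X) * D\<^sup>2"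
    proof (rule mult_right_mono)
      have "ln X \<le> \<alpha> * real j" using j_ge \<alpha> by (simp add: field_simps)
      then show "exp (- \<alpha>) ^ j \<le> exp (- ln X)"
        by (simp add: mult.commute flip: exp_of_nat_mult)
    qed simp
    finally show "(norm (w_prev ?s - x))\<^sup>2 \<le> exp (- ln X) * D\<^sup>2" .
  qed (use one_minus_\<sigma>2_bounds in simp)
  also have "\<dots> = \<tau>"
  proof -
    have "exp (- ln X) = 1 / X" using \<open>X > 0\<close> by (simp add: exp_minus inverse_eq_divide)
    then show ?thesis using assms one_minus_\<sigma>2_bounds by (simp add: X_def)
  qed
  finally have "stop (Suc j)" by (simp add: stop_def tseng_stop_def)
  define n where "n = (LEAST j. stop j)"
  have "stop n" unfolding n_def using \<open>stop (Suc j)\<close> by (rule LeastI)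
  moreover have "n \<le> Suc j" unfolding n_def using \<open>stop (Suc j)\<close> by (rule Least_le)
  moreover have "tseng_iterations C \<Omega> F1 F2 \<eta> \<gamma> z \<tau> = enat n"
    using \<open>stop n\<close> unfolding tseng_iterations_def Let_def n_def stop_def by auto
  ultimately show ?thesis
    using j_le by (auto simp: stop_def X_def \<alpha>_def intro!: exI[of _ n])
qed

end

subsection \<open>The outer algorithm\<close>

lemma le_infdist:
  assumes "X \<noteq> {}" and "\<And>a. a \<in> X \<Longrightarrow> c \<le> dist x a"
  shows "c \<le> infdist x X"
  using assms by (simp add: infdist_notempty cINF_greatest)

lemma log_plus_nonneg: "0 \<le> log_plus t"
  by (simp add: log_plus_def)

lemma ln_le_log_plus: "0 < t \<Longrightarrow> ln t \<le> log_plus t"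
  by (simp add: log_plus_def)

lemma sum_enat: "(\<Sum>i\<in>I. enat (f i)) = enat (\<Sum>i\<in>I. f i)"
  by (induction I rule: infinite_finite_induct) (simp_all add: zero_enat_def)

locale drt_splitting = tseng_splitting C \<Omega> F1 F2 L \<eta> \<sigma> \<gamma>
  for C :: "'a::{real_inner,complete_space} \<Rightarrow> 'a set"
    and \<Omega> :: "'a set" and F1 F2 :: "'a \<Rightarrow> 'a" and L \<eta> \<sigma> \<gamma> :: real +
  fixes A :: "'a \<Rightarrow> 'a set" and \<theta> M :: real
  assumes A_maximal: "maximal_monotone A"
    and \<theta>_pos: "0 < \<theta>" and \<theta>_less_1: "\<theta> < 1"
    and M_bound: "max (1 / (1 - \<sigma>)) (1 / \<sigma>) \<le> M"
begin

section \<open>A single outer iteration\<close>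

abbreviation step :: "'a \<Rightarrow> real \<Rightarrow> 'a drt_iterate" where
  "step \<equiv> drt_step A C \<Omega> F1 F2 \<eta> \<sigma> \<theta> \<gamma>"

abbreviation zer_S :: "'a set" where
  "zer_S \<equiv> operator_zeros (splitting_operator \<gamma> A B)"

text \<open>The record does not store which branch was taken, so the test is recovered from its
  fields and the point \<open>z\<close> before the step.\<close>

definition extragradient :: "'a \<Rightarrow> 'a drt_iterate \<Rightarrow> bool" where
  "extragradient z r \<longleftrightarrow> (norm (\<gamma> *\<^sub>R it_b r + it_x r - z))\<^sup>2 + 2 * \<gamma> * it_eps r
     \<le> \<sigma>\<^sup>2 * (norm (\<gamma> *\<^sub>R it_b r + it_y r - z))\<^sup>2"

lemma M_bounds: "1 \<le> M * (1 - \<sigma>)" "1 \<le> M * \<sigma>" "2 \<le> M"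
proof -
  show 1: "1 \<le> M * (1 - \<sigma>)" and 2: "1 \<le> M * \<sigma>"
    using M_bound \<sigma>_pos \<sigma>_less_1 by (simp_all add: divide_le_eq)
  \<comment> \<open>The sum of the two preceding bounds.\<close>
  show "2 \<le> M" using 1 2 by (simp add: algebra_simps)
qed

text \<open>A vanishing value forces \<open>a = - b\<close>, after which the coupling equation
  collapses to \<open>y = x\<close>.\<close>

lemma zer_S_iff: "z \<in> zer_S \<longleftrightarrow> (\<exists>x. \<exists>b\<in>B x. - b \<in> A x \<and> z = x + \<gamma> *\<^sub>R b)"
proof
  assume "z \<in> zer_S"
  then obtain a b x y where *: "b \<in> B x" "a \<in> A y" "\<gamma> *\<^sub>R a + y = x - \<gamma> *\<^sub>R b"
    "z = y + \<gamma> *\<^sub>R b" "0 = \<gamma> *\<^sub>R a + \<gamma> *\<^sub>R b"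
    unfolding operator_zeros_def splitting_operator_def by blast
  from *(5) have "\<gamma> *\<^sub>R (a + b) = 0" by (simp add: scaleR_add_right)
  then have "a = - b" using \<gamma>_pos by (simp add: eq_neg_iff_add_eq_0)
  with * have "y = x" by (simp add: algebra_simps)
  with * \<open>a = - b\<close> show "\<exists>x. \<exists>b\<in>B x. - b \<in> A x \<and> z = x + \<gamma> *\<^sub>R b" by blast
next
  assume "\<exists>x. \<exists>b\<in>B x. - b \<in> A x \<and> z = x + \<gamma> *\<^sub>R b"
  then obtain x b where "b \<in> B x" "- b \<in> A x" "z = x + \<gamma> *\<^sub>R b" by blast
  then show "z \<in> zer_S"
    unfolding operator_zeros_def splitting_operator_def mem_Collect_eq
    by (intro exI[of _ "- b"] exI[of _ b] exI[of _ x] conjI) auto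
qed

text \<open>Inner termination makes \<open>the_enat\<close> meaningful, and surjectivity of the
  resolvent equation for \<open>A\<close> makes the choice of \<open>(y, a)\<close> meaningful.
  Later arguments about outer iterations rest on these facts alone.\<close>

lemma step_spec:
  fixes z \<tau>
  assumes "\<tau> > 0"
  defines "r \<equiv> step z \<tau>"
  shows "it_inner r = tseng_iterations C \<Omega> F1 F2 \<eta> \<gamma> z \<tau>"
    and "it_F2 r = the_enat (it_inner r)"
    and "it_a r \<in> A (it_y r)"
    and "\<gamma> *\<^sub>R it_a r + it_y r = it_x r - \<gamma> *\<^sub>R it_b r"
    and "it_b r \<in> B_enl (it_eps r) (it_x r)"
    and "0 \<le> it_eps r"
    and "(norm (\<gamma> *\<^sub>R it_b r + it_x r - z))\<^sup>2 + 2 * \<gamma> * it_eps r \<le> \<tau>"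
    and "it_z r = (if extragradient z r then z - \<gamma> *\<^sub>R (it_a r + it_b r) else z)"
    and "it_tau r = (if extragradient z r then \<tau> else \<theta> * \<tau>)"
proof -
  obtain x0 b0 where "b0 \<in> B x0" "z = \<gamma> *\<^sub>R b0 + x0" using resolvent_B_exists[of z] by blast
  \<comment> \<open>Only termination matters here; adding 1 just makes the distance bound
    positive.\<close>
  from tseng_terminates[OF this, of "norm (z - x0) + 1" \<tau>] \<open>\<tau> > 0\<close>
  obtain n where n: "n \<ge> 1" "tseng_iterations C \<Omega> F1 F2 \<eta> \<gamma> z \<tau> = enat n"
    and stop: "tseng_stop \<gamma> \<eta> \<tau> (tseng_seq z n)"
    by (auto simp: add_nonneg_pos)
  define s where "s = tseng_seq z n"
  obtain j where "n = Suc j" using n by (cases n) auto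
  have mem: "(1 / \<gamma>) *\<^sub>R (z + w_prev s - (w_next s + w_tilde s))
      \<in> B_enl ((norm (w_proj s - w_tilde s))\<^sup>2 / (4 * \<eta>)) (w_tilde s)"
    unfolding s_def \<open>n = Suc j\<close> by (rule tseng_step_mem[OF tseng_seq_Suc(2-4)])
  define x where "x = w_tilde s"
  define b where "b = (1 / \<gamma>) *\<^sub>R (z + w_prev s - (w_next s + w_tilde s))"
  define e where "e = (norm (w_proj s - w_tilde s))\<^sup>2 / (4 * \<eta>)"
  have "\<exists>y. \<exists>a\<in>A y. x - \<gamma> *\<^sub>R b = \<gamma> *\<^sub>R a + y"
    using A_maximal \<gamma>_pos by (rule resolvent_solution_exists)
  then obtain y' a' where "a' \<in> A y'" "x - \<gamma> *\<^sub>R b = \<gamma> *\<^sub>R a' + y'" by blast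
  then have "\<exists>ya. case ya of (y, a) \<Rightarrow> a \<in> A y \<and> \<gamma> *\<^sub>R a + y = x - \<gamma> *\<^sub>R b"
    by (intro exI[of _ "(y', a')"]) simp
  then have some: "case (SOME (y, a). a \<in> A y \<and> \<gamma> *\<^sub>R a + y = x - \<gamma> *\<^sub>R b) of
      (y, a) \<Rightarrow> a \<in> A y \<and> \<gamma> *\<^sub>R a + y = x - \<gamma> *\<^sub>R b"
    by (rule someI_ex)
  obtain y a where ya: "(SOME (y, a). a \<in> A y \<and> \<gamma> *\<^sub>R a + y = x - \<gamma> *\<^sub>R b) = (y, a)"
    by (cases "SOME (y, a). a \<in> A y \<and> \<gamma> *\<^sub>R a + y = x - \<gamma> *\<^sub>R b")
  from some have a: "a \<in> A y" "\<gamma> *\<^sub>R a + y = x - \<gamma> *\<^sub>R b" unfolding ya by auto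
  define ext where "ext \<longleftrightarrow> (norm (\<gamma> *\<^sub>R b + x - z))\<^sup>2 + 2 * \<gamma> * e
      \<le> \<sigma>\<^sup>2 * (norm (\<gamma> *\<^sub>R b + y - z))\<^sup>2"
  have r: "r = \<lparr>it_z = (if ext then z - \<gamma> *\<^sub>R (a + b) else z), it_tau = (if ext then \<tau> else \<theta> * \<tau>),
      it_x = x, it_y = y, it_a = a, it_b = b, it_eps = e, it_inner = enat n, it_F2 = n\<rparr>"
    unfolding r_def drt_step_def n(2) Let_def the_enat.simps s_def[symmetric]
      x_def[symmetric] b_def[unfolded x_def[symmetric], symmetric] e_def[unfolded x_def[symmetric], symmetric]
      ya prod.case ext_def
    by (simp add: s_def n_F2_tseng_seq)
  have ext: "extragradient z r = ext" by (simp add: extragradient_def ext_def r)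
  \<comment> \<open>The left side of the extragradient test is exactly the inner stopping quantity,
    hence at most \<tau>.\<close>
  have "\<gamma> *\<^sub>R b + x - z = w_prev s - w_next s"
    using \<gamma>_pos by (simp add: b_def x_def)
  moreover have "2 * \<gamma> * e = \<gamma> * (norm (w_proj s - w_tilde s))\<^sup>2 / (2 * \<eta>)"
    using \<eta>_pos by (simp add: e_def)
  ultimately have \<tau>: "(norm (\<gamma> *\<^sub>R b + x - z))\<^sup>2 + 2 * \<gamma> * e \<le> \<tau>"
    using stop by (simp add: tseng_stop_def s_def)
  show "it_inner r = tseng_iterations C \<Omega> F1 F2 \<eta> \<gamma> z \<tau>" by (simp add: r n)
  show "it_F2 r = the_enat (it_inner r)" by (simp add: r)
  show "it_a r \<in> A (it_y r)" using a by (simp add: r)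
  show "\<gamma> *\<^sub>R it_a r + it_y r = it_x r - \<gamma> *\<^sub>R it_b r" using a by (simp add: r)
  show "it_b r \<in> B_enl (it_eps r) (it_x r)" using mem by (simp add: r b_def e_def x_def)
  show "0 \<le> it_eps r" using \<eta>_pos by (simp add: r e_def)
  show "(norm (\<gamma> *\<^sub>R it_b r + it_x r - z))\<^sup>2 + 2 * \<gamma> * it_eps r \<le> \<tau>" using \<tau> by (simp add: r)
  show "it_z r = (if extragradient z r then z - \<gamma> *\<^sub>R (it_a r + it_b r) else z)"
    unfolding ext by (simp add: r)
  show "it_tau r = (if extragradient z r then \<tau> else \<theta> * \<tau>)"
    unfolding ext by (simp add: r)
qed

text \<open>Adding the inequalities for \<open>A\<close> and for the enlarged \<open>B\<close> shows
  \<open>inner h v \<ge> - (\<gamma> * e)\<close>: the step direction \<open>v\<close> is an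
  approximate value of the splitting operator at \<open>y + \<gamma> *\<^sub>R b\<close>. Expanding
  the square then leaves an error that the test bounds by
  \<open>\<sigma>\<^sup>2 * (norm g)\<^sup>2\<close>.\<close>

lemma hybrid_proximal_extragradient_fejer:
  assumes a: "a \<in> A y" and b: "b \<in> B_enl e x" and res: "\<gamma> *\<^sub>R a + y = x - \<gamma> *\<^sub>R b"
    and err: "(norm (\<gamma> *\<^sub>R b + x - z))\<^sup>2 + 2 * \<gamma> * e \<le> \<sigma>\<^sup>2 * (norm (\<gamma> *\<^sub>R b + y - z))\<^sup>2"
    and zs: "zs \<in> zer_S"
  shows "(norm (z - \<gamma> *\<^sub>R (a + b) - zs))\<^sup>2 + (1 - \<sigma>\<^sup>2) * (norm (\<gamma> *\<^sub>R b + y - z))\<^sup>2 \<le> (norm (z - zs))\<^sup>2"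
proof -
  obtain xs bs where s: "bs \<in> B xs" "- bs \<in> A xs" "zs = xs + \<gamma> *\<^sub>R bs"
    using zs unfolding zer_S_iff by blast
  define v where "v = \<gamma> *\<^sub>R (a + b)"
  have x: "x = y + v" using res by (simp add: v_def algebra_simps)
  define h where "h = y + \<gamma> *\<^sub>R b - zs"
  define g where "g = \<gamma> *\<^sub>R b + y - z"
  have "inner (y - xs) (a + bs) \<ge> 0"
    using A_maximal a s(2) unfolding maximal_monotone_def monotone_operator_def
    by (metis diff_minus_eq_add)
  moreover have "inner (y + v - xs) (b - bs) \<ge> - e"
    using B_enl_monotone[OF b s(1)] by (simp add: x)
  ultimately have "\<gamma> * (inner (y - xs) (a + bs) + inner (y + v - xs) (b - bs)) \<ge> \<gamma> * (- e)"
    using \<gamma>_pos by (intro mult_left_mono) auto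
  also have "\<gamma> * (inner (y - xs) (a + bs) + inner (y + v - xs) (b - bs))
      = inner (y - xs) (\<gamma> *\<^sub>R (a + b)) + inner (\<gamma> *\<^sub>R (b - bs)) v"
    by (simp add: inner_add_left inner_add_right inner_diff_left inner_diff_right
        inner_commute[of v] algebra_simps)
  also have "\<dots> = inner h v"
    unfolding v_def[symmetric] inner_add_left[symmetric] by (simp add: h_def s algebra_simps)
  finally have hv: "inner h v \<ge> - (\<gamma> * e)" by simp
  have "z - \<gamma> *\<^sub>R (a + b) - zs = h - (g + v)" "z - zs = h - g" "\<gamma> *\<^sub>R b + x - z = g + v"
    by (simp_all add: h_def g_def v_def x algebra_simps)
  moreover have "(norm (h - (g + v)))\<^sup>2 = (norm (h - g))\<^sup>2 - 2 * inner h v + (norm (g + v))\<^sup>2 - (norm g)\<^sup>2"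
    by (simp add: norm_diff_squared inner_add_right)
  ultimately show ?thesis
    using err hv by (simp add: left_diff_distrib flip: g_def)
qed

end

locale drt_run = drt_splitting C \<Omega> F1 F2 L \<eta> \<sigma> \<gamma> A \<theta> M
  for C :: "'a::{real_inner,complete_space} \<Rightarrow> 'a set"
    and \<Omega> :: "'a set" and F1 F2 :: "'a \<Rightarrow> 'a" and L \<eta> \<sigma> \<gamma> :: real
    and A :: "'a \<Rightarrow> 'a set" and \<theta> M :: real +
  fixes \<rho> \<epsilon> \<tau>0 :: real and z0 :: 'a
  assumes \<rho>_pos: "\<rho> > 0" and \<epsilon>_pos: "\<epsilon> > 0" and \<tau>0_pos: "\<tau>0 > 0"
    and zeros_B_nonempty: "operator_zeros B \<noteq> {}"
    and zeros_sum_nonempty: "operator_zeros (\<lambda>x. A x + C x + {F1 x} + {F2 x}) \<noteq> {}"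
begin

section \<open>Outer steps that miss the tolerances\<close>

abbreviation success :: "'a drt_iterate \<Rightarrow> bool" where
  "success \<equiv> meets_tolerances A C F1 F2 \<gamma> \<rho> \<epsilon>"

text \<open>One threshold on the scale of squared norms, on which \<open>\<gamma> * it_eps\<close>
  also lives.\<close>

definition tol :: real where
  "tol = min (\<rho>\<^sup>2) (\<gamma> * \<epsilon>)"

lemma tol_pos: "tol > 0"
  using \<rho>_pos \<epsilon>_pos \<gamma>_pos by (simp add: tol_def)

text \<open>All other clauses of \<open>meets_tolerances\<close> hold at every step.\<close>

lemma step_failure:
  assumes "\<tau> > 0" and "\<not> success (step z \<tau>)"
  shows "norm (it_x (step z \<tau>) - it_y (step z \<tau>)) > \<rho> \<or> it_eps (step z \<tau>) > \<epsilon>"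
proof -
  define r where "r = step z \<tau>"
  note spec = step_spec[OF \<open>\<tau> > 0\<close>, of z, folded r_def]
  have "\<gamma> *\<^sub>R (it_a r + it_b r) = it_x r - it_y r"
    using spec(4) by (simp add: algebra_simps)
  then have "\<gamma> * norm (it_a r + it_b r) = norm (it_x r - it_y r)"
    using \<gamma>_pos by (metis abs_of_pos norm_scaleR)
  then show ?thesis
    using assms(2) spec(3,5,6) unfolding meets_tolerances_def r_def[symmetric] by auto
qed

text \<open>Missing \<rho> means \<open>\<rho> < G + V \<le> (1 + \<sigma>) * V\<close>; missing
  \<epsilon> means \<open>\<gamma> * \<epsilon> \<le> \<sigma>\<^sup>2 * V\<^sup>2\<close>. Both
  give \<open>tol \<le> 2 * (1 + \<sigma>) * V\<^sup>2\<close>, and the factor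
  \<open>M * (1 - \<sigma>) \<ge> 1\<close> turns this into a lower bound on the decrease
  \<open>(1 - \<sigma>\<^sup>2) * V\<^sup>2\<close>.\<close>

lemma failed_extragradient_step:
  assumes "\<tau> > 0" and "\<not> success (step z \<tau>)" and ext: "extragradient z (step z \<tau>)" and "zs \<in> zer_S"
  shows "(norm (it_z (step z \<tau>) - zs))\<^sup>2 + tol / (2 * M) \<le> (norm (z - zs))\<^sup>2"
proof -
  define r where "r = step z \<tau>"
  note spec = step_spec[OF \<open>\<tau> > 0\<close>, of z, folded r_def]
  define G where "G = norm (\<gamma> *\<^sub>R it_b r + it_x r - z)"
  define V where "V = norm (\<gamma> *\<^sub>R it_b r + it_y r - z)"
  have err: "G\<^sup>2 + 2 * \<gamma> * it_eps r \<le> \<sigma>\<^sup>2 * V\<^sup>2"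
    using ext unfolding extragradient_def r_def[symmetric] G_def V_def .
  have "tol \<le> 2 * (1 + \<sigma>) * V\<^sup>2"
    using step_failure[OF assms(1,2), folded r_def]
  proof
    assume "\<rho> < norm (it_x r - it_y r)"
    also have "it_x r - it_y r = (\<gamma> *\<^sub>R it_b r + it_x r - z) - (\<gamma> *\<^sub>R it_b r + it_y r - z)" by simp
    also have "norm \<dots> \<le> G + V" unfolding G_def V_def by (rule norm_triangle_ineq4)
    also have "G \<le> \<sigma> * V"
    proof (rule power2_le_imp_le)
      have "0 \<le> 2 * \<gamma> * it_eps r" using spec(6) \<gamma>_pos by simp
      then show "G\<^sup>2 \<le> (\<sigma> * V)\<^sup>2" using err by (simp add: power_mult_distrib)
      show "0 \<le> \<sigma> * V" using \<sigma>_pos by (simp add: V_def)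
    qed
    finally have "\<rho> < (1 + \<sigma>) * V" by (simp add: algebra_simps)
    then have "\<rho>\<^sup>2 \<le> ((1 + \<sigma>) * V)\<^sup>2" using \<rho>_pos by (intro power_mono) auto
    also have "\<dots> = (1 + \<sigma>) * ((1 + \<sigma>) * V\<^sup>2)" by (simp add: power2_eq_square)
    also have "\<dots> \<le> 2 * ((1 + \<sigma>) * V\<^sup>2)"
      using \<sigma>_pos \<sigma>_less_1 by (intro mult_right_mono) auto
    finally have "\<rho>\<^sup>2 \<le> 2 * (1 + \<sigma>) * V\<^sup>2" by (simp only: mult.assoc)
    then show ?thesis unfolding tol_def by (rule min.coboundedI1)
  next
    assume "\<epsilon> < it_eps r"
    then have "\<gamma> * \<epsilon> \<le> \<gamma> * it_eps r" using \<gamma>_pos by simp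
    also have "\<dots> \<le> \<sigma>\<^sup>2 * V\<^sup>2"
    proof -
      have "0 \<le> \<gamma> * it_eps r" using spec(6) \<gamma>_pos by simp
      then show ?thesis using err zero_le_power2[of G] by linarith
    qed
    also have "\<dots> \<le> 2 * (1 + \<sigma>) * V\<^sup>2"
      using one_minus_\<sigma>2_bounds \<sigma>_pos by (intro mult_right_mono) auto
    finally show ?thesis by (simp add: tol_def)
  qed
  also have "2 * (1 + \<sigma>) * V\<^sup>2 * 1 \<le> 2 * (1 + \<sigma>) * V\<^sup>2 * (M * (1 - \<sigma>))"
    using M_bounds(1) \<sigma>_pos by (intro mult_left_mono) auto
  finally have "tol / (2 * M) \<le> (1 - \<sigma>\<^sup>2) * V\<^sup>2"
    using M_bounds(3) by (simp add: field_simps power2_eq_square)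
  moreover have "(norm (it_z r - zs))\<^sup>2 + (1 - \<sigma>\<^sup>2) * V\<^sup>2 \<le> (norm (z - zs))\<^sup>2"
    unfolding V_def using hybrid_proximal_extragradient_fejer[OF spec(3,5,4) _ assms(4), of z]
      err ext spec(8) by (simp add: G_def V_def r_def)
  ultimately show ?thesis by (simp add: r_def)
qed

text \<open>The failed test gives \<open>\<sigma> * V \<le> sqrt \<tau>\<close>, so
  \<open>V \<le> M * sqrt \<tau>\<close>, while \<open>G \<le> sqrt \<tau>\<close> always holds.
  Their sum exceeds \<rho> if \<rho> is missed.\<close>

lemma failed_null_step:
  assumes "\<tau> > 0" and "\<not> success (step z \<tau>)" and null: "\<not> extragradient z (step z \<tau>)"
  shows "tol < (1 + M)\<^sup>2 * \<tau>"
proof -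
  define r where "r = step z \<tau>"
  note spec = step_spec[OF \<open>\<tau> > 0\<close>, of z, folded r_def]
  define G where "G = norm (\<gamma> *\<^sub>R it_b r + it_x r - z)"
  define V where "V = norm (\<gamma> *\<^sub>R it_b r + it_y r - z)"
  have err: "\<sigma>\<^sup>2 * V\<^sup>2 < G\<^sup>2 + 2 * \<gamma> * it_eps r"
    using null unfolding extragradient_def r_def[symmetric] G_def V_def by simp
  have \<tau>: "G\<^sup>2 + 2 * \<gamma> * it_eps r \<le> \<tau>" using spec(7) by (simp add: G_def)
  have nonneg: "0 \<le> \<gamma> * it_eps r" using spec(6) \<gamma>_pos by simp
  show ?thesis
    using step_failure[OF assms(1,2), folded r_def]
  proof
    assume "\<rho> < norm (it_x r - it_y r)"
    also have "it_x r - it_y r = (\<gamma> *\<^sub>R it_b r + it_x r - z) - (\<gamma> *\<^sub>R it_b r + it_y r - z)" by simp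
    also have "norm \<dots> \<le> G + V" unfolding G_def V_def by (rule norm_triangle_ineq4)
    also have "G \<le> sqrt \<tau>" using \<tau> nonneg by (intro real_le_rsqrt) linarith
    also have "V \<le> M * sqrt \<tau>"
    proof -
      have "(\<sigma> * V)\<^sup>2 \<le> \<tau>" using err \<tau> by (simp add: power_mult_distrib)
      then have "\<sigma> * V \<le> sqrt \<tau>" by (rule real_le_rsqrt)
      then have "M * (\<sigma> * V) \<le> M * sqrt \<tau>" using M_bounds(3) by (intro mult_left_mono) auto
      moreover have "1 * V \<le> (M * \<sigma>) * V" using M_bounds(2) by (intro mult_right_mono) (auto simp: V_def)
      ultimately show ?thesis by simp
    qed
    finally have "\<rho> < (1 + M) * sqrt \<tau>" by (simp add: algebra_simps)
    then have "\<rho>\<^sup>2 < ((1 + M) * sqrt \<tau>)\<^sup>2" using \<rho>_pos by (intro power_strict_mono) auto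
    then show ?thesis using \<open>\<tau> > 0\<close> by (simp add: tol_def power_mult_distrib)
  next
    assume "\<epsilon> < it_eps r"
    then have "\<gamma> * \<epsilon> < \<gamma> * it_eps r" using \<gamma>_pos by simp
    also have "\<dots> \<le> \<tau>" using \<tau> nonneg zero_le_power2[of G] by linarith
    also have "\<dots> \<le> (1 + M)\<^sup>2 * \<tau>"
      using M_bounds(3) \<open>\<tau> > 0\<close> by (simp add: one_le_power)
    finally show ?thesis by (simp add: tol_def)
  qed
qed

section \<open>Counting outer iterations\<close>

abbreviation iterate :: "nat \<Rightarrow> 'a drt_iterate" where
  "iterate \<equiv> drt A C \<Omega> F1 F2 \<eta> \<sigma> \<theta> \<gamma> z0 \<tau>0"

abbreviation d\<gamma> :: real where
  "d\<gamma> \<equiv> infdist z0 zer_S"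

abbreviation db :: real where
  "db \<equiv> infdist z0 (operator_zeros B)"

definition logs :: real where
  "logs = max (log_plus (sqrt \<tau>0 / \<rho>)) (log_plus (\<tau>0 / (\<gamma> * \<epsilon>)))"

definition outer_bound :: real where
  "outer_bound = outer_const M \<theta> * (1 + max (d\<gamma>\<^sup>2 / \<rho>\<^sup>2) (d\<gamma>\<^sup>2 / (\<gamma> * \<epsilon>)) + logs)"

definition inner_bound :: real where
  "inner_bound = inner_const M \<theta> * (1 + log_plus ((d\<gamma> + db) / sqrt \<tau>0) + logs)"

lemma logs_nonneg: "0 \<le> logs"
  by (simp add: logs_def log_plus_nonneg le_max_iff_disj)

lemma ln_inverse_\<theta>_pos: "0 < ln (1 / \<theta>)"
  using \<theta>_pos \<theta>_less_1 by (simp add: ln_div)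

text \<open>Lets plain numbers be absorbed into multiples of \<open>ln (1 + M)\<close>.\<close>

lemma one_le_ln_M: "1 \<le> ln (1 + M)"
proof -
  have "exp 1 \<le> 1 + M" using exp_le M_bounds(3) by linarith
  then show ?thesis using M_bounds(3) by (simp add: ln_ge_iff)
qed

text \<open>The factor 2 arises because \<open>logs\<close> contains
  \<open>sqrt \<tau>0 / \<rho>\<close>, whereas \<open>tol\<close> contains
  \<open>\<rho>\<^sup>2\<close>.\<close>

lemma ln_\<tau>0_tol: "ln (\<tau>0 / tol) \<le> 2 * logs"
proof -
  have "ln (\<tau>0 / \<rho>\<^sup>2) \<le> 2 * logs"
  proof -
    have "\<tau>0 / \<rho>\<^sup>2 = (sqrt \<tau>0 / \<rho>)\<^sup>2" using \<tau>0_pos by (simp add: power_divide)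
    then have "ln (\<tau>0 / \<rho>\<^sup>2) = 2 * ln (sqrt \<tau>0 / \<rho>)"
      using \<tau>0_pos \<rho>_pos by (simp add: ln_realpow)
    also have "\<dots> \<le> 2 * log_plus (sqrt \<tau>0 / \<rho>)"
      using \<tau>0_pos \<rho>_pos by (simp add: ln_le_log_plus)
    also have "\<dots> \<le> 2 * logs" by (simp add: logs_def)
    finally show ?thesis .
  qed
  moreover have "ln (\<tau>0 / (\<gamma> * \<epsilon>)) \<le> 2 * logs"
  proof -
    have "ln (\<tau>0 / (\<gamma> * \<epsilon>)) \<le> log_plus (\<tau>0 / (\<gamma> * \<epsilon>))"
      using \<tau>0_pos \<gamma>_pos \<epsilon>_pos by (simp add: ln_le_log_plus)
    also have "\<dots> \<le> logs" by (simp add: logs_def)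
    finally show ?thesis using logs_nonneg by linarith
  qed
  ultimately show ?thesis by (simp add: tol_def min_def)
qed

lemma zer_S_nonempty: "zer_S \<noteq> {}"
proof -
  obtain x where "0 \<in> A x + C x + {F1 x} + {F2 x}"
    using zeros_sum_nonempty by (auto simp: operator_zeros_def)
  then obtain a c where "a \<in> A x" "c \<in> C x" "0 = a + c + F1 x + F2 x"
    by (auto simp: mem_plus_singletons set_plus_def[of "A x" "C x"])
  moreover from this have "a = - (c + F1 x + F2 x)"
    by (metis add.assoc eq_neg_iff_add_eq_0)
  ultimately have "c + F1 x + F2 x \<in> B x" "- (c + F1 x + F2 x) \<in> A x"
    by (auto simp: mem_plus_singletons)
  then show ?thesis using zer_S_iff by blast
qed

text \<open>Here \<open>e\<close> and \<open>n\<close> count the extragradient and the null steps.\<close>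

lemma failed_iterations:
  assumes "\<And>i. 1 \<le> i \<Longrightarrow> i \<le> k \<Longrightarrow> \<not> success (iterate i)"
  shows "\<exists>e n :: nat. e + n = k \<and> it_tau (iterate k) = \<theta> ^ n * \<tau>0 \<and>
    (0 < n \<longrightarrow> tol < (1 + M)\<^sup>2 * (\<theta> ^ (n - 1) * \<tau>0)) \<and>
    (\<forall>zs\<in>zer_S. (norm (it_z (iterate k) - zs))\<^sup>2 + e * (tol / (2 * M)) \<le> (norm (z0 - zs))\<^sup>2)"
  using assms
proof (induction k)
  case 0
  then show ?case by simp
next
  case (Suc k)
  then obtain e n where en: "e + n = k" "it_tau (iterate k) = \<theta> ^ n * \<tau>0"
    "0 < n \<Longrightarrow> tol < (1 + M)\<^sup>2 * (\<theta> ^ (n - 1) * \<tau>0)"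
    and fejer: "\<And>zs. zs \<in> zer_S \<Longrightarrow>
      (norm (it_z (iterate k) - zs))\<^sup>2 + e * (tol / (2 * M)) \<le> (norm (z0 - zs))\<^sup>2"
    by auto
  define z \<tau> where "z = it_z (iterate k)" and "\<tau> = it_tau (iterate k)"
  have iter: "iterate (Suc k) = step z \<tau>" by (simp add: Let_def z_def \<tau>_def)
  have "\<tau> > 0" using en \<theta>_pos \<tau>0_pos by (simp add: \<tau>_def)
  have fail: "\<not> success (step z \<tau>)" using Suc.prems[of "Suc k"] iter by simp
  show ?case
  proof (cases "extragradient z (step z \<tau>)")
    case True
    have "(norm (it_z (step z \<tau>) - zs))\<^sup>2 + real (Suc e) * (tol / (2 * M)) \<le> (norm (z0 - zs))\<^sup>2"
      if "zs \<in> zer_S" for zs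
    proof -
      define T where "T = tol / (2 * M)"
      show ?thesis
        using failed_extragradient_step[OF \<open>\<tau> > 0\<close> fail True that] fejer[OF that]
        unfolding T_def[symmetric] z_def[symmetric] by (simp add: algebra_simps)
    qed
    moreover have "it_tau (step z \<tau>) = \<theta> ^ n * \<tau>0"
      using step_spec(9)[OF \<open>\<tau> > 0\<close>, of z] True en by (simp add: \<tau>_def)
    ultimately show ?thesis
      unfolding iter using en by (intro exI[of _ "Suc e"] exI[of _ n]) auto
  next
    case False
    have "it_z (step z \<tau>) = z"
      using step_spec(8)[OF \<open>\<tau> > 0\<close>, of z] False by simp
    moreover have "it_tau (step z \<tau>) = \<theta> ^ Suc n * \<tau>0"
      using step_spec(9)[OF \<open>\<tau> > 0\<close>, of z] False en by (simp add: \<tau>_def)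
    \<comment> \<open>The bound concerns the value of \<tau> entering the null step, one factor
      \<theta> short of the value after it; hence the exponent \<open>n - 1\<close> in the
      claim.\<close>
    moreover have "tol < (1 + M)\<^sup>2 * (\<theta> ^ n * \<tau>0)"
      using failed_null_step[OF \<open>\<tau> > 0\<close> fail False] en by (simp add: \<tau>_def)
    ultimately show ?thesis
      unfolding iter using en fejer by (intro exI[of _ e] exI[of _ "Suc n"]) (auto simp: z_def)
  qed
qed

text \<open>Logarithms of the bound at the last null step; the summand
  \<open>ln (1 / \<theta>)\<close> on the right pays for that step. The product form is what the
  inner bound needs for \<open>ln (\<theta> ^ n)\<close>.\<close>

lemma null_steps_le:
  assumes "0 < n \<Longrightarrow> tol < (1 + M)\<^sup>2 * (\<theta> ^ (n - 1) * \<tau>0)"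
  shows "n * ln (1 / \<theta>) \<le> ln (1 / \<theta>) + 2 * logs + 2 * ln (1 + M)"
proof (cases n)
  case 0
  then show ?thesis using ln_inverse_\<theta>_pos logs_nonneg one_le_ln_M by simp
next
  case (Suc m)
  have "ln tol < ln ((1 + M)\<^sup>2 * (\<theta> ^ m * \<tau>0))"
    using assms Suc tol_pos by (intro ln_less_cancel_iff[THEN iffD2]) auto
  also have "\<dots> = 2 * ln (1 + M) + (m * ln \<theta> + ln \<tau>0)"
    using M_bounds(3) \<theta>_pos \<tau>0_pos by (simp add: ln_mult ln_realpow)
  finally have "m * ln (1 / \<theta>) \<le> 2 * ln (1 + M) + ln (\<tau>0 / tol)"
    using \<theta>_pos \<tau>0_pos tol_pos by (simp add: ln_div)
  then show ?thesis using ln_\<tau>0_tol Suc by (simp add: algebra_simps)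
qed

text \<open>\<open>Suc k\<close> already counts the iteration after the failures. Extragradient
  steps are bounded by summing their decreases, null steps by \<open>null_steps_le\<close>.\<close>

lemma failed_iterations_le:
  assumes "\<And>i. 1 \<le> i \<Longrightarrow> i \<le> k \<Longrightarrow> \<not> success (iterate i)"
  shows "real (Suc k) \<le> outer_bound"
proof -
  have "\<exists>e n :: nat. e + n = k \<and> it_tau (iterate k) = \<theta> ^ n * \<tau>0 \<and>
    (0 < n \<longrightarrow> tol < (1 + M)\<^sup>2 * (\<theta> ^ (n - 1) * \<tau>0)) \<and>
    (\<forall>zs\<in>zer_S. (norm (it_z (iterate k) - zs))\<^sup>2 + e * (tol / (2 * M)) \<le> (norm (z0 - zs))\<^sup>2)"
    using assms by (rule failed_iterations)
  then obtain e n :: nat where "e + n = k"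
    and null: "0 < n \<Longrightarrow> tol < (1 + M)\<^sup>2 * (\<theta> ^ (n - 1) * \<tau>0)"
    and fejer: "\<And>zs. zs \<in> zer_S \<Longrightarrow>
      (norm (it_z (iterate k) - zs))\<^sup>2 + e * (tol / (2 * M)) \<le> (norm (z0 - zs))\<^sup>2"
    by blast
  define X where "X = max (d\<gamma>\<^sup>2 / \<rho>\<^sup>2) (d\<gamma>\<^sup>2 / (\<gamma> * \<epsilon>))"
  define l where "l = ln (1 / \<theta>)"
  define q where "q = ln (1 + M) / l"
  have l: "l > 0" unfolding l_def by (rule ln_inverse_\<theta>_pos)
  have "q \<ge> 0" using l one_le_ln_M by (simp add: q_def)
  have "X \<ge> 0" by (simp add: X_def le_max_iff_disj)
  have e: "e \<le> 2 * M * X"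
  proof -
    \<comment> \<open>The bound holds for the squared distance to every zero; the root allows
      passing to the infimum of distances.\<close>
    have "sqrt (e * (tol / (2 * M))) \<le> d\<gamma>"
    proof (rule le_infdist[OF zer_S_nonempty])
      fix zs assume "zs \<in> zer_S"
      then have "e * (tol / (2 * M)) \<le> (dist z0 zs)\<^sup>2"
        using fejer[of zs] zero_le_power2[of "norm (it_z (iterate k) - zs)"]
        unfolding dist_norm by linarith
      then show "sqrt (e * (tol / (2 * M))) \<le> dist z0 zs" by (simp add: real_le_lsqrt)
    qed
    then have "(sqrt (e * (tol / (2 * M))))\<^sup>2 \<le> d\<gamma>\<^sup>2"
      using tol_pos M_bounds(3) by (intro power_mono) auto
    then have "e * (tol / (2 * M)) \<le> d\<gamma>\<^sup>2" using tol_pos M_bounds(3) by simp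
    then have "e \<le> 2 * M * (d\<gamma>\<^sup>2 / tol)" using tol_pos M_bounds(3) by (simp add: field_simps)
    also have "d\<gamma>\<^sup>2 / tol \<le> X" by (simp add: X_def tol_def min_def)
    finally show ?thesis using M_bounds(3) by simp
  qed
  have "n \<le> 1 + (2 * logs) / l + 2 * q"
    using null_steps_le[OF null] l by (simp add: q_def field_simps flip: l_def)
  \<comment> \<open>Inserting \<open>ln (1 + M) \<ge> 1\<close> makes this a multiple of
    \<open>q\<close>, matching \<open>outer_const\<close>.\<close>
  also have "(2 * logs) / l \<le> (2 * logs * ln (1 + M)) / l"
    using mult_left_mono[OF one_le_ln_M, of "2 * logs"] logs_nonneg l
    by (intro divide_right_mono) auto
  also have "\<dots> = 2 * q * logs" by (simp add: q_def)
  finally have n: "n \<le> 1 + 2 * q * logs + 2 * q" by simp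
  have "real (Suc k) \<le> 2 + 2 * M * X + 2 * q * logs + 2 * q"
    using e n \<open>e + n = k\<close> by (simp flip: of_nat_add)
  also have "\<dots> \<le> (4 * M + 4 * q) * (1 + X + logs)"
  proof -
    have "0 \<le> M * X" "0 \<le> M * logs" "0 \<le> q * X" "0 \<le> q * logs"
      using M_bounds(3) \<open>X \<ge> 0\<close> \<open>q \<ge> 0\<close> logs_nonneg by simp_all
    moreover have "(4 * M + 4 * q) * (1 + X + logs)
        = 4 * M + 4 * (M * X) + 4 * (M * logs) + 4 * q + 4 * (q * X) + 4 * (q * logs)"
      by (simp add: algebra_simps)
    ultimately show ?thesis using M_bounds(3) \<open>q \<ge> 0\<close> by linarith
  qed
  also have "4 * M + 4 * q = outer_const M \<theta>" by (simp add: outer_const_def q_def l_def)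
  finally show ?thesis by (simp only: X_def outer_bound_def)
qed

lemma first_success:
  obtains k where "1 \<le> k" and "success (iterate k)"
    and "\<And>i. 1 \<le> i \<Longrightarrow> i < k \<Longrightarrow> \<not> success (iterate i)"
proof -
  have "\<exists>k. 1 \<le> k \<and> success (iterate k)"
  proof (rule ccontr)
    assume none: "\<nexists>k. 1 \<le> k \<and> success (iterate k)"
    obtain k where "outer_bound < real k" using reals_Archimedean2 by blast
    moreover have "real (Suc k) \<le> outer_bound"
      using none by (intro failed_iterations_le) blast
    ultimately show False by simp
  qed
  moreover define P where "P k \<longleftrightarrow> 1 \<le> k \<and> success (iterate k)" for k
  moreover define k where "k = (LEAST k. P k)"
  ultimately have "P k" by (metis LeastI)
  have least: "\<not> P i" if "i < k" for i using that unfolding k_def by (rule not_less_Least)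
  show ?thesis
  proof (rule that)
    show "1 \<le> k" "success (iterate k)" using \<open>P k\<close> by (simp_all add: P_def)
    show "\<not> success (iterate i)" if "1 \<le> i" "i < k" for i
      using least[OF that(2)] that(1) by (simp add: P_def)
  qed
qed

section \<open>Bounding inner iterations and collecting the bounds\<close>

text \<open>Up to the first success the iterates stay near \<open>z0\<close> by the Fejer property
  and \<tau> has undergone few reductions, so \<open>tseng_terminates\<close> applies with uniform
  data.\<close>

lemma inner_iterations_le:
  assumes "1 \<le> k" and fail: "\<And>i. 1 \<le> i \<Longrightarrow> i < k \<Longrightarrow> \<not> success (iterate i)"
  shows "\<exists>n. it_inner (iterate k) = enat n \<and> it_F2 (iterate k) = n \<and> real n \<le> inner_bound"
proof -
  obtain m where k: "k = Suc m" using assms(1) by (cases k) auto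
  have "\<exists>e n :: nat. e + n = m \<and> it_tau (iterate m) = \<theta> ^ n * \<tau>0 \<and>
    (0 < n \<longrightarrow> tol < (1 + M)\<^sup>2 * (\<theta> ^ (n - 1) * \<tau>0)) \<and>
    (\<forall>zs\<in>zer_S. (norm (it_z (iterate m) - zs))\<^sup>2 + e * (tol / (2 * M)) \<le> (norm (z0 - zs))\<^sup>2)"
    by (rule failed_iterations) (use fail k in simp)
  then obtain e n :: nat where "e + n = m"
    and \<tau>: "it_tau (iterate m) = \<theta> ^ n * \<tau>0"
    and null: "0 < n \<Longrightarrow> tol < (1 + M)\<^sup>2 * (\<theta> ^ (n - 1) * \<tau>0)"
    and fejer: "\<And>zs. zs \<in> zer_S \<Longrightarrow>
      (norm (it_z (iterate m) - zs))\<^sup>2 + e * (tol / (2 * M)) \<le> (norm (z0 - zs))\<^sup>2"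
    by blast
  define z where "z = it_z (iterate m)"
  define \<tau>m where "\<tau>m = \<theta> ^ n * \<tau>0"
  have "\<tau>m > 0" using \<theta>_pos \<tau>0_pos by (simp add: \<tau>m_def)
  have iter: "iterate k = step z \<tau>m" by (simp add: k Let_def z_def \<tau>m_def \<tau>)
  obtain x b where sol: "b \<in> B x" "z = \<gamma> *\<^sub>R b + x" using resolvent_B_exists[of z] by blast
  have zx: "norm (z - x) \<le> 2 * d\<gamma> + db"
  proof -
    have "norm (z - x) - dist z0 p \<le> 2 * dist z0 zs" if "zs \<in> zer_S" "p \<in> operator_zeros B" for zs p
    proof -
      have "(norm (z - zs))\<^sup>2 \<le> (norm (z0 - zs))\<^sup>2"
      proof -
        have "0 \<le> e * (tol / (2 * M))" using tol_pos M_bounds(3) by simp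
        then show ?thesis using fejer[OF that(1)] unfolding z_def by linarith
      qed
      then have "dist z zs \<le> dist z0 zs"
        unfolding dist_norm by (rule power2_le_imp_le) simp
      moreover have "norm (z - x) \<le> dist z p"
        using norm_diff_resolvent_B_le[OF sol, of p] that(2) by (simp add: operator_zeros_def dist_norm)
      moreover have "dist z p \<le> dist z zs + dist z0 zs + dist z0 p"
        using dist_triangle[of z p z0] dist_triangle[of z z0 zs] by (simp add: dist_commute)
      ultimately show ?thesis by linarith
    qed
    \<comment> \<open>The two infima are taken one after the other, so no nearest zero has to
      exist.\<close>
    then have "norm (z - x) - 2 * dist z0 zs \<le> db" if "zs \<in> zer_S" for zs
      using that by (intro le_infdist[OF zeros_B_nonempty]) (force simp: algebra_simps)
    then have "(norm (z - x) - db) / 2 \<le> d\<gamma>"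
      by (intro le_infdist[OF zer_S_nonempty]) (force simp: field_simps)
    then show ?thesis by (simp add: field_simps)
  qed
  define u where "u = (d\<gamma> + db) / sqrt \<tau>0"
  \<comment> \<open>The maximum with 1 keeps \<open>D\<close> positive when both distances vanish.\<close>
  define y where "y = max (2 * u) 1"
  define D where "D = sqrt \<tau>0 * y"
  define s where "s = 1 - \<sigma>\<^sup>2"
  define l where "l = ln (1 / \<theta>)"
  define \<Lambda> where "\<Lambda> = ln (1 + M)"
  define p where "p = log_plus u"
  have "y \<ge> 1" by (simp add: y_def)
  then have "D > 0" using \<tau>0_pos by (simp add: D_def)
  have "norm (z - x) \<le> D"
  proof -
    have "2 * d\<gamma> + db \<le> 2 * (d\<gamma> + db)" by (simp add: infdist_nonneg)
    also have "\<dots> = sqrt \<tau>0 * (2 * u)" using \<tau>0_pos by (simp add: u_def)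
    also have "\<dots> \<le> D" unfolding D_def y_def using \<tau>0_pos by (intro mult_left_mono) auto
    finally show ?thesis using zx by linarith
  qed
  from tseng_terminates[OF sol this \<open>D > 0\<close> \<open>\<tau>m > 0\<close>]
  obtain N where N: "tseng_iterations C \<Omega> F1 F2 \<eta> \<gamma> z \<tau>m = enat N"
    and N_le: "real N \<le> 2 + max 0 (ln (4 * D\<^sup>2 / (s * \<tau>m))) / contraction_gap"
    by (auto simp: s_def)
  have s: "0 < s" "s < 1" using one_minus_\<sigma>2_bounds by (simp_all add: s_def)
  have Ms: "1 \<le> M * s"
  proof -
    have "1 - \<sigma> \<le> s" using \<sigma>_pos \<sigma>_less_1 by (simp add: s_def power2_eq_square mult_left_le)
    then have "M * (1 - \<sigma>) \<le> M * s" using M_bounds(3) by (intro mult_left_mono) auto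
    then show ?thesis using M_bounds(1) by linarith
  qed
  have \<Lambda>: "1 \<le> \<Lambda>" "ln 2 \<le> \<Lambda>" "ln M \<le> \<Lambda>"
    using one_le_ln_M M_bounds(3) by (auto simp: \<Lambda>_def)
  have nonneg: "0 \<le> p" "0 \<le> logs" "0 < l"
    using log_plus_nonneg logs_nonneg ln_inverse_\<theta>_pos by (auto simp: p_def l_def)
  \<comment> \<open>The 7 collects 2 from \<open>ln 4\<close>, 2 from \<open>2 * ln 2\<close>, 1
    from \<open>- ln s\<close> and 2 from \<open>null_steps_le\<close>.\<close>
  define W where "W = 7 * \<Lambda> + 2 * p + l + 2 * logs"
  have "W \<ge> 0" using \<Lambda> nonneg by (simp add: W_def)
  have "ln (4 * D\<^sup>2 / (s * \<tau>m)) \<le> W"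
  proof -
    have "ln y \<le> ln 2 + p"
    proof (cases "2 * u \<le> 1")
      case True
      then show ?thesis using nonneg by (simp add: y_def max_def)
    next
      case False
      then have "ln y = ln 2 + ln u" by (simp add: y_def ln_mult)
      then show ?thesis using False ln_le_log_plus[of u] by (simp add: p_def)
    qed
    moreover have "- ln s \<le> ln M"
    proof -
      have "0 \<le> ln (M * s)" using Ms by simp
      then show ?thesis using s M_bounds(3) by (simp add: ln_mult)
    qed
    \<comment> \<open>The factor \<open>sqrt \<tau>0\<close> in \<open>D\<close> cancels the \<tau>0
      in \<open>\<tau>m\<close>, leaving only the power of \<theta>.\<close>
    moreover have "ln (4 * D\<^sup>2 / (s * \<tau>m)) = ln 4 + 2 * ln y - ln s + n * l"
    proof -
      have "4 * D\<^sup>2 / (s * \<tau>m) = 4 * y\<^sup>2 / (s * \<theta> ^ n)"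
        using \<tau>0_pos by (simp add: D_def \<tau>m_def power_mult_distrib)
      then show ?thesis
        using s \<theta>_pos \<open>y \<ge> 1\<close> by (simp add: ln_div ln_mult ln_realpow l_def)
    qed
    moreover have "ln (4::real) = 2 * ln 2" using ln_realpow[of 2 2] by simp
    moreover have "n * l \<le> l + 2 * logs + 2 * \<Lambda>"
      using null_steps_le[OF null] by (simp add: l_def \<Lambda>_def)
    ultimately show ?thesis using \<Lambda> by (simp add: W_def)
  qed
  then have "max 0 (ln (4 * D\<^sup>2 / (s * \<tau>m))) / contraction_gap \<le> W / contraction_gap"
    using \<open>W \<ge> 0\<close> contraction_gap_bounds by (intro divide_right_mono) auto
  also have "\<dots> = W * (1 / contraction_gap)" by simp
  also have "\<dots> \<le> W * (3 * M / 2)"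
  proof (rule mult_left_mono)
    have "3 - \<sigma>\<^sup>2 \<le> 3 * (M * s)" using Ms zero_le_power2[of \<sigma>] by linarith
    then show "1 / contraction_gap \<le> 3 * M / 2" using s by (simp add: s_def field_simps)
  qed (fact \<open>W \<ge> 0\<close>)
  finally have "real N \<le> 2 + W * (3 * M / 2)"
    using N_le by linarith
  also have "\<dots> \<le> 12 * M * (1 + \<Lambda> + l) * (1 + p + logs)"
  proof -
    \<comment> \<open>The 2 is absorbed by \<open>M\<close>; each coefficient on the right is at
      most 12.\<close>
    have "2 + W * (3 * M / 2) \<le> M * (1 + 21 / 2 * \<Lambda> + 3 * p + 3 / 2 * l + 3 * logs)"
      using M_bounds(3) by (simp add: W_def algebra_simps)
    also have "\<dots> \<le> M * (12 * ((1 + \<Lambda> + l) * (1 + p + logs)))"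
    proof (rule mult_left_mono)
      have "0 \<le> \<Lambda> * p" "0 \<le> \<Lambda> * logs" "0 \<le> l * p" "0 \<le> l * logs"
        using \<Lambda> nonneg by simp_all
      moreover have "(1 + \<Lambda> + l) * (1 + p + logs)
          = 1 + \<Lambda> + l + p + logs + \<Lambda> * p + \<Lambda> * logs + l * p + l * logs"
        by (simp add: algebra_simps)
      ultimately show "1 + 21 / 2 * \<Lambda> + 3 * p + 3 / 2 * l + 3 * logs
          \<le> 12 * ((1 + \<Lambda> + l) * (1 + p + logs))"
        using \<Lambda> nonneg by linarith
    qed (use M_bounds(3) in simp)
    finally show ?thesis by (simp add: mult.assoc)
  qed
  finally have "real N \<le> inner_bound"
    by (simp add: inner_bound_def inner_const_def \<Lambda>_def l_def p_def u_def)
  moreover have "it_inner (iterate k) = enat N"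
    unfolding iter step_spec(1)[OF \<open>\<tau>m > 0\<close>] by (rule N)
  moreover have "it_F2 (iterate k) = N"
    unfolding iter step_spec(2)[OF \<open>\<tau>m > 0\<close>] step_spec(1)[OF \<open>\<tau>m > 0\<close>] by (simp add: N)
  ultimately show ?thesis by blast
qed

lemma complexity_bounds:
  shows "\<exists>k\<ge>1. real k \<le> outer_bound \<and> success (iterate k)"
    and "\<forall>k\<ge>1. (\<forall>i. 1 \<le> i \<and> i < k \<longrightarrow> \<not> success (iterate i)) \<longrightarrow>
      (\<exists>n. it_inner (iterate k) = enat n \<and> real n \<le> inner_bound) \<and>
      real (it_F2 (iterate k)) \<le> inner_bound"
    and "\<exists>k\<ge>1. success (iterate k) \<and>
      (\<exists>N. (\<Sum>i=1..k. it_inner (iterate i)) = enat N \<and> real N \<le> outer_bound * inner_bound)"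
proof -
  obtain k where k: "1 \<le> k" "success (iterate k)"
    and fail: "\<And>i. 1 \<le> i \<Longrightarrow> i < k \<Longrightarrow> \<not> success (iterate i)"
    using first_success by blast
  have k_le: "real k \<le> outer_bound"
  proof -
    obtain m where m: "k = Suc m" using k(1) by (cases k) auto
    show ?thesis unfolding m by (rule failed_iterations_le) (simp add: fail m)
  qed
  show "\<exists>k\<ge>1. real k \<le> outer_bound \<and> success (iterate k)"
    using k k_le by (intro exI[of _ k] conjI)
  show "\<forall>k\<ge>1. (\<forall>i. 1 \<le> i \<and> i < k \<longrightarrow> \<not> success (iterate i)) \<longrightarrow>
      (\<exists>n. it_inner (iterate k) = enat n \<and> real n \<le> inner_bound) \<and>
      real (it_F2 (iterate k)) \<le> inner_bound"
  proof (intro allI impI)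
    fix k assume "1 \<le> k" "\<forall>i. 1 \<le> i \<and> i < k \<longrightarrow> \<not> success (iterate i)"
    then obtain n where "it_inner (iterate k) = enat n" "it_F2 (iterate k) = n"
      "real n \<le> inner_bound"
      using inner_iterations_le[of k] by metis
    then show "(\<exists>n. it_inner (iterate k) = enat n \<and> real n \<le> inner_bound) \<and>
        real (it_F2 (iterate k)) \<le> inner_bound"
      by auto
  qed
  have "\<forall>i\<in>{1..k}. \<exists>n. it_inner (iterate i) = enat n \<and> real n \<le> inner_bound"
  proof
    fix i assume "i \<in> {1..k}"
    then have "1 \<le> i" "\<And>j. 1 \<le> j \<Longrightarrow> j < i \<Longrightarrow> \<not> success (iterate j)"
      using fail by auto
    from inner_iterations_le[OF this]
    show "\<exists>n. it_inner (iterate i) = enat n \<and> real n \<le> inner_bound" by blast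
  qed
  then obtain f where f: "\<And>i. i \<in> {1..k} \<Longrightarrow> it_inner (iterate i) = enat (f i)"
    "\<And>i. i \<in> {1..k} \<Longrightarrow> real (f i) \<le> inner_bound"
    by metis
  have "(\<Sum>i=1..k. it_inner (iterate i)) = enat (\<Sum>i=1..k. f i)"
    unfolding sum_enat[symmetric] by (rule sum.cong) (auto simp: f(1))
  moreover have "real (\<Sum>i=1..k. f i) \<le> outer_bound * inner_bound"
  proof -
    have "real (\<Sum>i=1..k. f i) \<le> real k * inner_bound"
      using sum_bounded_above[of "{1..k}" "\<lambda>i. real (f i)" inner_bound] f(2) by simp
    also have "\<dots> \<le> outer_bound * inner_bound"
    proof (rule mult_right_mono[OF k_le])
      \<comment> \<open>Since \<open>k\<close> is at least 1, the first term witnesses that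
        \<open>inner_bound\<close> is nonnegative.\<close>
      have "real (f 1) \<le> inner_bound" using k(1) by (intro f(2)) simp
      then show "0 \<le> inner_bound" by (rule order_trans[OF of_nat_0_le_iff])
    qed
    finally show ?thesis .
  qed
  ultimately show "\<exists>k\<ge>1. success (iterate k) \<and>
      (\<exists>N. (\<Sum>i=1..k. it_inner (iterate i)) = enat N \<and> real N \<le> outer_bound * inner_bound)"
    using k by blast
qed

end

theorem theorem4p3:
  fixes A C :: "'a::{real_inner,complete_space} \<Rightarrow> 'a set"
    and \<Omega> D1 :: "'a set"
    and F1 F2 :: "'a \<Rightarrow> 'a"
    and L \<eta> \<sigma> \<theta> \<gamma> \<tau>0 \<rho> \<epsilon> M :: real
    and z0 :: 'a
  assumes "maximal_monotone A" and "maximal_monotone C"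
    and "\<Omega> \<noteq> {}" and "closed \<Omega>" and "convex \<Omega>"
    and "operator_domain C \<subseteq> \<Omega>" and "\<Omega> \<subseteq> D1"
    and "\<And>z z'. z \<in> \<Omega> \<Longrightarrow> z' \<in> \<Omega> \<Longrightarrow> inner (F1 z - F1 z') (z - z') \<ge> 0"
    and "L \<ge> 0"
    and "\<And>z z'. z \<in> \<Omega> \<Longrightarrow> z' \<in> \<Omega> \<Longrightarrow> norm (F1 z - F1 z') \<le> L * norm (z - z')"
    and "\<eta> > 0"
    and "\<And>z z'. inner (F2 z - F2 z') (z - z') \<ge> \<eta> * (norm (F2 z - F2 z'))\<^sup>2"
    and "operator_zeros (\<lambda>x. C x + {F1 x} + {F2 x}) \<noteq> {}"
    and "operator_zeros (\<lambda>x. A x + C x + {F1 x} + {F2 x}) \<noteq> {}"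
    and "\<tau>0 > 0"
    and "0 < \<sigma>" and "\<sigma> < 1" and "0 < \<theta>" and "\<theta> < 1"
    and "0 < \<gamma>" and "\<gamma> \<le> 4 * \<eta> * \<sigma>\<^sup>2 / (1 + sqrt (1 + 16 * L\<^sup>2 * \<eta>\<^sup>2 * \<sigma>\<^sup>2))"
    and "max (1 / (1 - \<sigma>)) (1 / \<sigma>) \<le> M"
    and "\<rho> > 0" and "\<epsilon> > 0"
  shows
    "let B = (\<lambda>x. C x + {F1 x} + {F2 x});
         d\<gamma> = infdist z0 (operator_zeros (splitting_operator \<gamma> A B));
         db = infdist z0 (operator_zeros B);
         logs = max (log_plus (sqrt \<tau>0 / \<rho>)) (log_plus (\<tau>0 / (\<gamma> * \<epsilon>)));
         k_outer = outer_const M \<theta> * (1 + max (d\<gamma>\<^sup>2 / \<rho>\<^sup>2) (d\<gamma>\<^sup>2 / (\<gamma> * \<epsilon>)) + logs);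
         k_inner = inner_const M \<theta> * (1 + log_plus ((d\<gamma> + db) / sqrt \<tau>0) + logs);
         R = drt A C \<Omega> F1 F2 \<eta> \<sigma> \<theta> \<gamma> z0 \<tau>0;
         success = (\<lambda>k. meets_tolerances A C F1 F2 \<gamma> \<rho> \<epsilon> (R k))
     in (\<exists>k\<ge>1. real k \<le> k_outer \<and> success k) \<and>
        (\<forall>k\<ge>1. (\<forall>i. 1 \<le> i \<and> i < k \<longrightarrow> \<not> success i) \<longrightarrow>
           (\<exists>n. it_inner (R k) = enat n \<and> real n \<le> k_inner) \<and>
           real (it_F2 (R k)) \<le> k_inner) \<and>
        (\<exists>k\<ge>1. success k \<and>
           (\<exists>N. (\<Sum>i=1..k. it_inner (R i)) = enat N \<and> real N \<le> k_outer * k_inner))"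
proof -
  interpret drt_run C \<Omega> F1 F2 L \<eta> \<sigma> \<gamma> A \<theta> M \<rho> \<epsilon> \<tau>0 z0
    by unfold_locales (fact assms)+
  show ?thesis
    unfolding Let_def using complexity_bounds unfolding outer_bound_def inner_bound_def logs_def
    by (intro conjI)
qed

end
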